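(* Endow $\mathbb{C}[\Pi(n)]$ with the $\mathfrak{S}_n$-action $w\star\pi:=\mathrm{sign}(w)\cdot w(\pi)$ and $\mathbb{C}[\mathrm{NC}(n)]$ with the skein action. Then the projection $p:\mathbb{C}[\Pi(n)]\twoheadrightarrow\mathbb{C}[\mathrm{NC}(n)]$ is $\mathfrak{S}_n$-equivariant.
   Context: Set partitions. $\Pi(n)$ is the set of all set partitions of $[n]$; $\mathrm{NC}(n)$ is the set of noncrossing ones (whenever $a<b<c<d$ with $a,c$ in the same block and $b,d$ in the same block, all four are in the same block). $\mathbb{C}[X]$ denotes the vector space with basis $X$. For $w\in\mathfrak{S}_n$, $w(\pi)$ is the set partition with blocks $w(B)$, $B$ a block of $\pi$; $s_i=(i,i+1)$. Skein action. For $\mu\in\Pi(n)$ not noncrossing with $s_i(\mu)$ noncrossing, the indices $i,i+1$ lie in different blocks $B_i\ni i$, $B_{i+1}\ni i+1$ of $\mu$, both of size at least 2. Let $\mu_1,\dots,\mu_4$ be obtained from $\mu$ by replacing the pair $B_i,B_{i+1}$ by the pair: $(B_i-\{i\})\cup\{i+1\}$ and $(B_{i+1}-\{i+1\})\cup\{i\}$ for $\mu_1$; $(B_i\cup B_{i+1})-\{i,i+1\}$ and $\{i,i+1\}$ for $\mu_2$; $B_i-\{i\}$ and $B_{i+1}\cup\{i\}$ for $\mu_3$; $B_{i+1}-\{i+1\}$ and $B_i\cup\{i+1\}$ for $\mu_4$. Set $\sigma(\mu)=\mu_1+\mu_2$ if $|B_i|=|B_{i+1}|=2$; $\mu_1+\mu_2-\mu_3$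 if $|B_i|>2,|B_{i+1}|=2$; $\mu_1+\mu_2-\mu_4$ if $|B_i|=2,|B_{i+1}|>2$; $\mu_1+\mu_2-\mu_3-\mu_4$ if $|B_i|,|B_{i+1}|>2$; this lies in $\mathbb{C}[\mathrm{NC}(n)]$. The skein action is given on generators by $s_i\cdot\pi=-s_i(\pi)$ if $s_i(\pi)$ is noncrossing and $s_i\cdot\pi=\sigma(s_i(\pi))$ otherwise ($\pi\in\mathrm{NC}(n)$). These operators satisfy the Coxeter relations, so they define an action of $\mathfrak{S}_n$ on $\mathbb{C}[\mathrm{NC}(n)]$. Fermions. $\wedge\{\Theta_n,\Xi_n\}$ is the exterior algebra over $\mathbb{C}$ on anticommuting generators $\theta_1,\dots,\theta_n,\xi_1,\dots,\xi_n$. For a generator $\omega$, $\omega\odot(-)$ is the linear operator sending a product $\omega_1\cdots\omega_r$ of distinct generators to $(-1)^{s-1}\omega_1\cdots\widehat{\omega_s}\cdots\omega_r$ if $\omega=\omega_s$ and to $0$ if $\omega\notin\{\omega_1,\dots,\omega_r\}$. For nonempty $B\subseteq[n]$, $\rho_B(f)=\sum_{i,j\in B,\ i\neq j}\xi_i\cdot(\theta_j\odot f)$ if $|B|>1$ and $\rho_B(f)=\xi_i\cdot(\theta_i\odot f)$ if $B=\{i\}$. These operators commute pairwise. For $\pi=\{B_1/\cdots/B_k\}\in\Pi(n)$, $F_\pi=(\rho_{B_1}\circ\cdots\circ\rho_{B_k})(\theta_1\cdots\theta_n)$. Projection $p$. The set $\{F_\mu:\mu\in\mathrm{NC}(n)\}$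 is a basis of $\mathrm{span}\{F_\pi:\pi\in\Pi(n)\}$, so for each $\pi\in\Pi(n)$ there are unique coefficients with $F_\pi=\sum_{\mu\in\mathrm{NC}(n)}c_{\pi,\mu}F_\mu$. The linear map $p:\mathbb{C}[\Pi(n)]\to\mathbb{C}[\mathrm{NC}(n)]$ is defined by $p(\pi)=\sum_{\mu\in\mathrm{NC}(n)}c_{\pi,\mu}\,\mu$. *)

theory Defs
  imports
    Complex_Main
    "HOL-Library.Disjoint_Sets"
    "HOL-Library.Function_Algebras"
    "HOL-Combinatorics.Permutations"
begin

section \<open>Vector spaces with a given finite basis\<close>

text \<open>For a finite set \<open>X\<close>, the space \<open>\<complex>[X]\<close> consists of the coefficient functions supported
  in \<open>X\<close>.  Addition and subtraction of coefficient functions are the pointwise operations of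
  \<open>Function_Algebras\<close>; its pointwise product is not used.\<close>

definition free_space :: "'a set \<Rightarrow> ('a \<Rightarrow> complex) set" where
  "free_space X = {v. \<forall>x. x \<notin> X \<longrightarrow> v x = 0}"

definition basis_vec :: "'a \<Rightarrow> 'a \<Rightarrow> complex" where
  "basis_vec x = (\<lambda>y. if y = x then 1 else 0)"

definition scale :: "complex \<Rightarrow> ('a \<Rightarrow> complex) \<Rightarrow> 'a \<Rightarrow> complex" where
  "scale c v = (\<lambda>x. c * v x)"

text \<open>The linear map on \<open>\<complex>[X]\<close> whose value on the basis vector \<open>x\<close> is \<open>T x\<close>.\<close>

definition lin_ext :: "'a set \<Rightarrow> ('a \<Rightarrow> 'b \<Rightarrow> complex) \<Rightarrow> ('a \<Rightarrow> complex) \<Rightarrow> 'b \<Rightarrow> complex" where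
  "lin_ext X T v = (\<Sum>x\<in>X. scale (v x) (T x))"


section \<open>Set partitions\<close>

type_synonym setpart = "nat set set"

definition Parts :: "nat \<Rightarrow> setpart set" where
  "Parts n = {\<pi>. partition_on {1..n} \<pi>}"

definition noncrossing :: "setpart \<Rightarrow> bool" where
  "noncrossing \<pi> \<longleftrightarrow>
    (\<forall>a b c d. a < b \<and> b < c \<and> c < d \<and>
       (\<exists>B\<in>\<pi>. a \<in> B \<and> c \<in> B) \<and> (\<exists>B\<in>\<pi>. b \<in> B \<and> d \<in> B) \<longrightarrow> (\<exists>B\<in>\<pi>. {a, b, c, d} \<subseteq> B))"

definition NC :: "nat \<Rightarrow> setpart set" where
  "NC n = {\<pi> \<in> Parts n. noncrossing \<pi>}"

definition perm_part :: "(nat \<Rightarrow> nat) \<Rightarrow> setpart \<Rightarrow> setpart" where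
  "perm_part w \<pi> = (\<lambda>B. w ` B) ` \<pi>"

definition star :: "nat \<Rightarrow> (nat \<Rightarrow> nat) \<Rightarrow> (setpart \<Rightarrow> complex) \<Rightarrow> setpart \<Rightarrow> complex" where
  "star n w = lin_ext (Parts n) (\<lambda>\<pi>. scale (of_int (sign w)) (basis_vec (perm_part w \<pi>)))"


section \<open>The skein action\<close>

abbreviation adj :: "nat \<Rightarrow> nat \<Rightarrow> nat" where
  "adj i \<equiv> transpose i (Suc i)"

definition block_of :: "setpart \<Rightarrow> nat \<Rightarrow> nat set" where
  "block_of \<pi> i = (THE B. B \<in> \<pi> \<and> i \<in> B)"

definition skein_resolve :: "nat \<Rightarrow> setpart \<Rightarrow> setpart \<Rightarrow> complex" where
  "skein_resolve i \<mu> =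
    (let B = block_of \<mu> i;
         C = block_of \<mu> (Suc i);
         R = \<mu> - {B, C};
         \<mu>1 = R \<union> {(B - {i}) \<union> {Suc i}, (C - {Suc i}) \<union> {i}};
         \<mu>2 = R \<union> {(B \<union> C) - {i, Suc i}, {i, Suc i}};
         \<mu>3 = R \<union> {B - {i}, C \<union> {i}};
         \<mu>4 = R \<union> {C - {Suc i}, B \<union> {Suc i}}
     in basis_vec \<mu>1 + basis_vec \<mu>2
        - (if card B > 2 then basis_vec \<mu>3 else 0)
        - (if card C > 2 then basis_vec \<mu>4 else 0))"

definition skein_gen :: "nat \<Rightarrow> nat \<Rightarrow> (setpart \<Rightarrow> complex) \<Rightarrow> setpart \<Rightarrow> complex" where
  "skein_gen n i =
    lin_ext (NC n)
      (\<lambda>\<pi>. if noncrossing (perm_part (adj i) \<pi>) then - basis_vec (perm_part (adj i) \<pi>)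
           else skein_resolve i (perm_part (adj i) \<pi>))"

text \<open>The action of \<open>w \<in> S\<^sub>n\<close>: the common value of \<open>s\<^bsub>i1\<^esub> \<cdot> (s\<^bsub>i2\<^esub> \<cdot> (\<dots> \<cdot> v))\<close> over all words
  \<open>i1, i2, \<dots>\<close> in \<open>{1..<n}\<close> with \<open>w = s\<^bsub>i1\<^esub> s\<^bsub>i2\<^esub> \<dots>\<close>.  It does not depend on the word because the
  generators satisfy the Coxeter relations.\<close>

definition skein_act ::
  "nat \<Rightarrow> (nat \<Rightarrow> nat) \<Rightarrow> (setpart \<Rightarrow> complex) \<Rightarrow> setpart \<Rightarrow> complex" where
  "skein_act n w v =
    (THE u. \<exists>is. set is \<subseteq> {1..<n} \<and> w = foldr (\<lambda>i g. adj i \<circ> g) is id \<and>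
                 u = foldr (skein_gen n) is v)"


section \<open>Fermions\<close>

datatype fermion = Theta nat | Xi nat

instantiation fermion :: linorder
begin

fun less_eq_fermion :: "fermion \<Rightarrow> fermion \<Rightarrow> bool" where
  "Theta i \<le> Theta j \<longleftrightarrow> i \<le> j"
| "Theta i \<le> Xi j \<longleftrightarrow> True"
| "Xi i \<le> Theta j \<longleftrightarrow> False"
| "Xi i \<le> Xi j \<longleftrightarrow> i \<le> j"

definition less_fermion :: "fermion \<Rightarrow> fermion \<Rightarrow> bool" where
  "(x :: fermion) < y \<longleftrightarrow> x \<le> y \<and> \<not> y \<le> x"

instance
proof
  fix x y z :: fermion
  show "x < y \<longleftrightarrow> x \<le> y \<and> \<not> y \<le> x" by (rule less_fermion_def)
  show "x \<le> x" by (cases x) auto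
  show "x \<le> y \<Longrightarrow> y \<le> z \<Longrightarrow> x \<le> z" by (cases x; cases y; cases z) auto
  show "x \<le> y \<Longrightarrow> y \<le> x \<Longrightarrow> x = y" by (cases x; cases y) auto
  show "x \<le> y \<or> y \<le> x" by (cases x; cases y) auto
qed

end

text \<open>An element of the exterior algebra is given by its coefficients: the coefficient at a finite
  set \<open>{\<omega>\<^sub>1 < \<dots> < \<omega>\<^sub>r}\<close> belongs to the monomial \<open>\<omega>\<^sub>1 \<dots> \<omega>\<^sub>r\<close>.  The generators \<open>\<theta>\<^sub>i, \<xi>\<^sub>i\<close> are
  available for all \<open>i\<close>; the algebra on \<open>\<theta>\<^sub>1, \<dots>, \<theta>\<^sub>n, \<xi>\<^sub>1, \<dots>, \<xi>\<^sub>n\<close> is the subalgebra of elements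
  supported on sets of these.\<close>

type_synonym ext = "fermion set \<Rightarrow> complex"

definition ext_one :: ext where
  "ext_one = basis_vec {}"

definition ext_gen :: "fermion \<Rightarrow> ext" where
  "ext_gen \<omega> = basis_vec {\<omega>}"

text \<open>The sign is that of sorting the concatenation of the two sorted monomials \<open>S\<close> and \<open>U - S\<close>.\<close>

definition ext_mult :: "ext \<Rightarrow> ext \<Rightarrow> ext" where
  "ext_mult f g =
    (\<lambda>U. \<Sum>S\<in>Pow U. (- 1) ^ card {(s, t). s \<in> S \<and> t \<in> U - S \<and> t < s} * f S * g (U - S))"

definition monomial :: "fermion list \<Rightarrow> ext" where
  "monomial \<omega>s = foldr (\<lambda>\<omega> f. ext_mult (ext_gen \<omega>) f) \<omega>s ext_one"

definition below :: "fermion \<Rightarrow> fermion set \<Rightarrow> nat" where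
  "below \<omega> U = card {u \<in> U. u < \<omega>}"

text \<open>The operator \<open>\<omega> \<odot> (-)\<close>, given on sorted monomials; lemma \<open>contract_monomial\<close> below gives
  the rule for a product of distinct generators in any order.\<close>

definition contract :: "fermion \<Rightarrow> ext \<Rightarrow> ext" where
  "contract \<omega> f =
    (\<lambda>U. if \<omega> \<in> U then 0 else (- 1) ^ below \<omega> U * f (insert \<omega> U))"

definition rho :: "nat set \<Rightarrow> ext \<Rightarrow> ext" where
  "rho B f =
    (if card B > 1
     then \<Sum>(i, j)\<in>{(i, j). i \<in> B \<and> j \<in> B \<and> i \<noteq> j}. ext_mult (ext_gen (Xi i)) (contract (Theta j) f)
     else ext_mult (ext_gen (Xi (the_elem B))) (contract (Theta (the_elem B)) f))"

text \<open>The operators \<open>rho B\<close> commute pairwise, so the fold is their composition over all blocks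
  in any order.\<close>

definition F :: "nat \<Rightarrow> setpart \<Rightarrow> ext" where
  "F n \<pi> = Finite_Set.fold rho (monomial (map Theta [1..<Suc n])) \<pi>"


section \<open>The projection\<close>

definition proj_coeff :: "nat \<Rightarrow> setpart \<Rightarrow> setpart \<Rightarrow> complex" where
  "proj_coeff n \<pi> = (THE c. c \<in> free_space (NC n) \<and> F n \<pi> = (\<Sum>\<mu>\<in>NC n. scale (c \<mu>) (F n \<mu>)))"

definition proj :: "nat \<Rightarrow> (setpart \<Rightarrow> complex) \<Rightarrow> setpart \<Rightarrow> complex" where
  "proj n = lin_ext (Parts n) (proj_coeff n)"


section \<open>Basic rules for the exterior algebra\<close>

lemma below_insert:
  assumes "finite U" "x \<notin> U"
  shows "below v (insert x U) = (if x < v then Suc (below v U) else below v U)"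
proof -
  have "{u \<in> insert x U. u < v} = (if x < v then insert x {u \<in> U. u < v} else {u \<in> U. u < v})"
    by auto
  then show ?thesis using assms by (auto simp: below_def)
qed

lemma ext_mult_gen:
  "ext_mult (ext_gen \<omega>) f U =
    (if finite U \<and> \<omega> \<in> U then (- 1) ^ below \<omega> U * f (U - {\<omega>}) else 0)"
proof (cases "finite U")
  case False
  then show ?thesis by (simp add: ext_mult_def)
next
  case True
  let ?h = "\<lambda>S. (- 1) ^ card {(s, t). s \<in> S \<and> t \<in> U - S \<and> t < s} * ext_gen \<omega> S * f (U - S)"
  have "ext_mult (ext_gen \<omega>) f U = sum ?h (Pow U)"
    by (simp add: ext_mult_def)
  also have "\<dots> = (\<Sum>S\<in>Pow U. if S = {\<omega>} then ?h {\<omega>} else 0)"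
    by (rule sum.cong) (auto simp: ext_gen_def basis_vec_def)
  also have "\<dots> = (if \<omega> \<in> U then ?h {\<omega>} else 0)"
    using True by (simp add: sum.delta)
  also have "{(s, t). s \<in> {\<omega>} \<and> t \<in> U - {\<omega>} \<and> t < s} = Pair \<omega> ` {u \<in> U. u < \<omega>}"
    by auto
  also have "card \<dots> = below \<omega> U"
    unfolding below_def by (rule card_image) (auto simp: inj_on_def)
  finally show ?thesis using True by (simp add: ext_gen_def basis_vec_def)
qed

lemma gen_anticommute:
  "ext_mult (ext_gen \<omega>) (ext_mult (ext_gen v) f) = - ext_mult (ext_gen v) (ext_mult (ext_gen \<omega>) f)"
proof
  fix U
  show "ext_mult (ext_gen \<omega>) (ext_mult (ext_gen v) f) U =
      (- ext_mult (ext_gen v) (ext_mult (ext_gen \<omega>) f)) U"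
  proof (cases "finite U \<and> \<omega> \<in> U \<and> v \<in> U \<and> \<omega> \<noteq> v")
    case False
    then show ?thesis by (auto simp: ext_mult_gen)
  next
    case True
    define W where "W = U - {\<omega>, v}"
    have W: "finite W" "\<omega> \<notin> W" "v \<notin> W" "\<omega> \<noteq> v" "U = insert \<omega> (insert v W)"
      using True by (auto simp: W_def)
    have d: "insert \<omega> (insert v W) - {\<omega>} = insert v W" "insert \<omega> (insert v W) - {v} = insert \<omega> W"
      "insert v W - {v} = W" "insert \<omega> W - {\<omega>} = W"
      using W by auto
    consider "\<omega> < v" "\<not> v < \<omega>" | "v < \<omega>" "\<not> \<omega> < v"
      using W(4) by fastforce
    then show ?thesis
      using W(1-4) by cases (simp_all add: W(5) ext_mult_gen d below_insert)
  qed
qed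

lemma contract_gen_mult:
  assumes "\<And>U. infinite U \<Longrightarrow> f U = 0"
  shows "contract \<omega> (ext_mult (ext_gen v) f) =
    (if v = \<omega> then f else 0) - ext_mult (ext_gen v) (contract \<omega> f)"
proof
  fix U
  show "contract \<omega> (ext_mult (ext_gen v) f) U =
      ((if v = \<omega> then f else 0) - ext_mult (ext_gen v) (contract \<omega> f)) U"
  proof (cases "finite U")
    case False
    then show ?thesis using assms by (auto simp: contract_def ext_mult_gen)
  next
    case fin: True
    show ?thesis
    proof (cases "v = \<omega>")
      case True
      show ?thesis
      proof (cases "\<omega> \<in> U")
        case mem: True
        then have "insert \<omega> (U - {\<omega>}) = U" "below \<omega> (U - {\<omega>}) = below \<omega> U"
          by (auto simp: below_def intro!: arg_cong[where f = card])
        with True fin mem show ?thesis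
          by (simp add: contract_def ext_mult_gen flip: mult.assoc power_add)
      next
        case False
        with True fin show ?thesis
          by (simp add: contract_def ext_mult_gen below_insert flip: mult.assoc power_add)
      qed
    next
      case ne: False
      show ?thesis
      proof (cases "v \<in> U \<and> \<omega> \<notin> U")
        case True
        define W where "W = U - {v}"
        have W: "finite W" "\<omega> \<notin> W" "v \<notin> W" "U = insert v W"
          using True fin by (auto simp: W_def)
        have d: "insert \<omega> (insert v W) - {v} = insert \<omega> W" "insert v W - {v} = W"
          using W ne by auto
        consider "\<omega> < v" "\<not> v < \<omega>" | "v < \<omega>" "\<not> \<omega> < v"
          using ne by fastforce
        then show ?thesis
          using W(1-3) ne by cases (simp_all add: W(4) contract_def ext_mult_gen d below_insert)
      qed (use ne fin in \<open>auto simp: contract_def ext_mult_gen\<close>)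
    qed
  qed
qed

lemma monomial_infinite: "infinite U \<Longrightarrow> monomial \<omega>s U = 0"
  by (cases \<omega>s) (auto simp: monomial_def ext_one_def basis_vec_def ext_mult_gen)

lemma monomial_Cons: "monomial (\<omega> # \<omega>s) = ext_mult (ext_gen \<omega>) (monomial \<omega>s)"
  by (simp add: monomial_def)

lemma contract_monomial_Cons:
  "contract \<omega> (monomial (v # vs)) =
    (if v = \<omega> then monomial vs else 0) - ext_mult (ext_gen v) (contract \<omega> (monomial vs))"
  unfolding monomial_Cons by (rule contract_gen_mult) (rule monomial_infinite)

lemma ext_mult_gen_zero: "ext_mult (ext_gen v) 0 = 0"
  by (rule ext) (simp add: ext_mult_gen)

lemma contract_monomial_notin:
  "\<omega> \<notin> set \<omega>s \<Longrightarrow> contract \<omega> (monomial \<omega>s) = 0"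
proof (induction \<omega>s)
  case Nil
  show ?case by (rule ext) (auto simp: monomial_def contract_def ext_one_def basis_vec_def)
next
  case (Cons v vs)
  then have v: "v \<noteq> \<omega>" "\<omega> \<notin> set vs" by auto
  from v(1) Cons.IH[OF v(2)] show ?case
    unfolding contract_monomial_Cons by (simp only: ext_mult_gen_zero if_False diff_0_right)
qed

lemma contract_monomial:
  assumes "distinct (us @ \<omega> # vs)"
  shows "contract \<omega> (monomial (us @ \<omega> # vs)) = scale ((- 1) ^ length us) (monomial (us @ vs))"
  using assms
proof (induction us)
  case Nil
  then have "contract \<omega> (monomial vs) = 0"
    by (intro contract_monomial_notin) auto
  then show ?case
    unfolding append_Nil contract_monomial_Cons
    by (simp only: ext_mult_gen_zero if_True diff_0_right) (simp add: scale_def)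
next
  case (Cons u us)
  then have "contract \<omega> (monomial (us @ \<omega> # vs)) = scale ((- 1) ^ length us) (monomial (us @ vs))"
    and "u \<noteq> \<omega>" by auto
  then show ?case
    unfolding append_Cons contract_monomial_Cons
    by (intro ext) (simp add: monomial_Cons ext_mult_gen scale_def)
qed

end

theory Submission
  imports Defs
begin

text \<open>
  The transposition \<open>s\<^sub>i\<close> acts on the exterior algebra by exchanging indices, and it sends \<open>F\<^sub>\<pi>\<close>
  to \<open>- F\<^bsub>s\<^sub>i(\<pi>)\<^esub>\<close>, since \<open>\<theta>\<^sub>1\<dots>\<theta>\<^sub>n\<close> changes sign.  The linear map \<open>\<pi> \<mapsto> F\<^sub>\<pi>\<close> therefore
  intertwines \<open>\<star>\<close> with this action.  On noncrossing partitions it also intertwines the skein action,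
  because of the skein relation \<open>F\<^sub>\<mu> = - F\<^bsub>\<sigma>(\<mu>)\<^esub>\<close>, which comes from an identity between
  the operators of two disjoint blocks.  Equivariance of \<open>p\<close> follows once the \<open>F\<^sub>\<mu>\<close> with \<open>\<mu>\<close>
  noncrossing are a basis of the span of all \<open>F\<^sub>\<pi>\<close>.

  Spanning: every partition is a permutation of one into intervals, and the span of the noncrossing
  \<open>F\<^sub>\<mu>\<close> is stable under the \<open>s\<^sub>i\<close> by the skein relation.  Independence: take the coefficient of
  \<open>F\<^sub>\<rho>\<close> at the monomial with \<open>\<xi>\<close> at the block minima of \<open>\<mu>\<close> and \<open>\<theta>\<close> away from its block maxima.
  If it is nonzero, these minima and maxima are transversals of \<open>\<rho>\<close>, so the sum of (maximum - minimum)
  over the blocks is at least as large for \<open>\<rho>\<close> as for \<open>\<mu>\<close>, with equality only if \<open>\<rho>\<close> and \<open>\<mu>\<close> have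
  the same minima and maxima; these determine a noncrossing partition.
\<close>

section \<open>Linear maps between spaces of coefficient functions\<close>

interpretation fun_space: vector_space "scale :: complex \<Rightarrow> ('a \<Rightarrow> complex) \<Rightarrow> 'a \<Rightarrow> complex"
  by unfold_locales (auto simp: scale_def algebra_simps fun_eq_iff)

abbreviation lin :: "(('a \<Rightarrow> complex) \<Rightarrow> 'b \<Rightarrow> complex) \<Rightarrow> bool" where
  "lin \<equiv> Vector_Spaces.linear scale scale"

lemma linI:
  assumes "\<And>f g. L (f + g) = L f + L g" "\<And>c f. L (scale c f) = scale c (L f)"
  shows "lin L"
  by (rule linear_module_homI) (unfold_locales; fact assms)

lemmas lin_add = module_hom.add[OF module_hom_linearI]
lemmas lin_scale = module_hom.scale[OF module_hom_linearI]
lemmas lin_zero = module_hom.zero[OF module_hom_linearI]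
lemmas lin_neg = module_hom.neg[OF module_hom_linearI]
lemmas lin_diff = module_hom.diff[OF module_hom_linearI]
lemmas lin_sum = module_hom.sum[OF module_hom_linearI]

lemma sum_apply: "(\<Sum>x\<in>A. f x) y = (\<Sum>x\<in>A. f x y)" for f :: "'a \<Rightarrow> 'b \<Rightarrow> complex"
  by (induction A rule: infinite_finite_induct) auto

lemma lin_sum_fun:
  assumes "\<And>x. x \<in> A \<Longrightarrow> lin (L x)"
  shows "lin (\<lambda>f. \<Sum>x\<in>A. L x f)"
proof (rule linI)
  show "(\<Sum>x\<in>A. L x (f + g)) = (\<Sum>x\<in>A. L x f) + (\<Sum>x\<in>A. L x g)" for f g
    unfolding sum.distrib[symmetric] by (rule sum.cong) (simp_all add: lin_add[OF assms])
  show "(\<Sum>x\<in>A. L x (scale c f)) = scale c (\<Sum>x\<in>A. L x f)" for c f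
    unfolding fun_space.scale_sum_right by (rule sum.cong) (simp_all add: lin_scale[OF assms])
qed

lemma lin_lin_ext: "lin (lin_ext X T)"
  unfolding lin_ext_def[abs_def]
  by (rule linI) (simp_all add: scale_def fun_eq_iff sum_apply algebra_simps sum.distrib sum_distrib_left)

lemma lin_ext_apply_lin: "lin L \<Longrightarrow> L (lin_ext X T v) = lin_ext X (\<lambda>x. L (T x)) v"
  by (simp add: lin_ext_def lin_sum lin_scale)

lemma lin_ext_basis_vec:
  assumes "finite X" "x \<in> X"
  shows "lin_ext X T (basis_vec x) = T x"
proof -
  have "lin_ext X T (basis_vec x) = (\<Sum>y\<in>X. if y = x then T y else 0)"
    unfolding lin_ext_def by (rule sum.cong) (auto simp: basis_vec_def scale_def)
  with assms show ?thesis by simp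
qed

lemma lin_ext_cong: "(\<And>x. x \<in> X \<Longrightarrow> S x = T x) \<Longrightarrow> lin_ext X S v = lin_ext X T v"
  by (simp add: lin_ext_def)

lemma subspace_free_space: "fun_space.subspace (free_space X)"
  by (rule fun_space.subspaceI) (auto simp: free_space_def scale_def)

lemma lin_ext_in_subspace:
  "fun_space.subspace V \<Longrightarrow> (\<And>x. x \<in> X \<Longrightarrow> T x \<in> V) \<Longrightarrow> lin_ext X T v \<in> V"
  unfolding lin_ext_def by (intro fun_space.subspace_sum fun_space.subspace_scale)

lemma basis_vec_in_free_space: "x \<in> X \<Longrightarrow> basis_vec x \<in> free_space X"
  by (auto simp: free_space_def basis_vec_def)

section \<open>Skein relations for the block operators\<close>

definition move :: "nat \<Rightarrow> nat \<Rightarrow> ext \<Rightarrow> ext" where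
  "move i j f = ext_mult (ext_gen (Xi i)) (contract (Theta j) f)"

text \<open>Every \<xi> lies above every \<theta> in the order on generators, so the sign of the
  contraction inside \<open>move\<close> can be read off at \<open>U\<close> itself.\<close>

lemma below_Theta_remove_Xi: "below (Theta j) (U - {Xi i}) = below (Theta j) U"
  unfolding below_def by (intro arg_cong[where f = card]) (auto simp: less_fermion_def)

lemma move_apply:
  "move i j f U = (if finite U \<and> Xi i \<in> U \<and> Theta j \<notin> U
     then (- 1) ^ (below (Xi i) U + below (Theta j) U) * f (insert (Theta j) (U - {Xi i})) else 0)"
  by (auto simp: move_def ext_mult_gen contract_def below_Theta_remove_Xi power_add)

lemma lin_move: "lin (move i j)"
  by (rule linI) (auto simp: fun_eq_iff move_apply scale_def algebra_simps)

text \<open>An arbitrary \<open>f\<close> may be nonzero at infinite sets, where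
  \<open>contract_gen_mult\<close> does not apply. Both sides read \<open>f\<close> only at finite
  sets, so it may be replaced by its truncation \<open>g\<close>.\<close>

lemma contract_Theta_Xi:
  "contract (Theta j) (ext_mult (ext_gen (Xi k)) f) = - ext_mult (ext_gen (Xi k)) (contract (Theta j) f)"
proof -
  define g where "g = (\<lambda>U. if finite U then f U else 0)"
  have "contract (Theta j) (ext_mult (ext_gen (Xi k)) f)
      = contract (Theta j) (ext_mult (ext_gen (Xi k)) g)"
    by (auto simp: fun_eq_iff contract_def ext_mult_gen g_def)
  also have "\<dots> = - ext_mult (ext_gen (Xi k)) (contract (Theta j) g)"
    by (subst contract_gen_mult) (auto simp: g_def)
  also have "ext_mult (ext_gen (Xi k)) (contract (Theta j) g)
      = ext_mult (ext_gen (Xi k)) (contract (Theta j) f)"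
    by (auto simp: fun_eq_iff contract_def ext_mult_gen g_def)
  finally show ?thesis .
qed

lemma ext_mult_gen_minus: "ext_mult (ext_gen v) (- f) = - ext_mult (ext_gen v) f"
  by (auto simp: fun_eq_iff ext_mult_gen)

lemma contract_anticommute:
  assumes "finite U"
  shows "contract v (contract w f) U = - contract w (contract v f) U"
proof (cases "v \<notin> U \<and> w \<notin> U \<and> v \<noteq> w")
  case True
  then consider "w < v" "\<not> v < w" | "v < w" "\<not> w < v"
    by fastforce
  then show ?thesis using True assms
    by cases (auto simp: contract_def below_insert insert_commute)
qed (auto simp: contract_def)

lemma move_move:
  "move i j (move k l f) =
    - ext_mult (ext_gen (Xi i)) (ext_mult (ext_gen (Xi k)) (contract (Theta j) (contract (Theta l) f)))"
  by (simp add: move_def contract_Theta_Xi ext_mult_gen_minus)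

lemma move_swap_Xi: "move i j (move k l f) = - move k j (move i l f)"
  by (subst (1 2) move_move) (subst gen_anticommute, simp)

lemma move_swap_Theta: "move i j (move k l f) = - move i l (move k j f)"
  by (auto simp: fun_eq_iff move_move ext_mult_gen contract_anticommute[of _ "Theta j"])

lemma move_commute: "move i j (move k l f) = move k l (move i j f)"
  by (subst move_swap_Xi, subst move_swap_Theta) simp

text \<open>For finite \<open>B\<close>, \<open>moves (offdiag B)\<close> agrees with
  \<open>rho B\<close> except on singletons, where it vanishes. This is what merges the four cases
  in the definition of \<sigma> into one identity.\<close>

definition offdiag :: "nat set \<Rightarrow> (nat \<times> nat) set" where
  "offdiag B = {(i, j). i \<in> B \<and> j \<in> B \<and> i \<noteq> j}"

definition rho_moves :: "nat set \<Rightarrow> (nat \<times> nat) set" where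
  "rho_moves B = (if card B > 1 then offdiag B else {(the_elem B, the_elem B)})"

definition moves :: "(nat \<times> nat) set \<Rightarrow> ext \<Rightarrow> ext" where
  "moves X f = (\<Sum>(i, j)\<in>X. move i j f)"

lemma rho_eq_moves: "rho B = moves (rho_moves B)"
  by (rule ext) (simp add: rho_def rho_moves_def offdiag_def move_def moves_def)

lemma lin_moves: "lin (moves X)"
  unfolding moves_def[abs_def] split_def by (intro lin_sum_fun lin_move)

lemma lin_rho: "lin (rho B)"
  by (simp add: rho_eq_moves lin_moves)

lemma moves_commute: "moves X (moves Y f) = moves Y (moves X f)"
proof -
  have "moves X (moves Y f)
      = (\<Sum>p\<in>X. \<Sum>q\<in>Y. move (fst p) (snd p) (move (fst q) (snd q) f))"
    by (simp add: moves_def split_def lin_sum[OF lin_move])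
  also have "\<dots> = (\<Sum>q\<in>Y. \<Sum>p\<in>X. move (fst q) (snd q) (move (fst p) (snd p) f))"
    by (subst sum.swap) (simp add: move_commute)
  also have "\<dots> = moves Y (moves X f)"
    by (simp add: moves_def split_def lin_sum[OF lin_move])
  finally show ?thesis .
qed

lemma comp_fun_commute_rho: "comp_fun_commute rho"
  by unfold_locales (auto simp: fun_eq_iff rho_eq_moves moves_commute)

text \<open>For disjoint finite \<open>A\<close> and \<open>D\<close> this is the polarization of
  the off-diagonal operator: the mixed pairs in \<open>offdiag (A \<union> D)\<close>.\<close>

definition cross :: "nat set \<Rightarrow> nat set \<Rightarrow> ext \<Rightarrow> ext" where
  "cross A D f = (\<Sum>i\<in>A. \<Sum>j\<in>D. move i j f + move j i f)"

lemma cross_eq_moves: "cross A D f = moves (A \<times> D) f + moves (D \<times> A) f"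
proof -
  have "cross A D f = (\<Sum>i\<in>A. \<Sum>j\<in>D. move i j f) + (\<Sum>i\<in>A. \<Sum>j\<in>D. move j i f)"
    by (simp add: cross_def sum.distrib)
  also have "(\<Sum>i\<in>A. \<Sum>j\<in>D. move j i f) = (\<Sum>j\<in>D. \<Sum>i\<in>A. move j i f)"
    by (rule sum.swap)
  finally show ?thesis
    unfolding moves_def sum.cartesian_product .
qed

lemma lin_cross: "lin (cross A D)"
  unfolding cross_eq_moves[abs_def] by (rule linI) (simp_all add: lin_add[OF lin_moves]
      lin_scale[OF lin_moves] fun_space.scale_right_distrib)

lemma moves_cross_commute: "moves X (cross A D f) = cross A D (moves X f)"
  by (simp add: cross_eq_moves lin_add[OF lin_moves] moves_commute)

lemma moves_offdiag_Un:
  assumes "finite A" "finite D" "A \<inter> D = {}"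
  shows "moves (offdiag (A \<union> D)) f
    = moves (offdiag A) f + moves (offdiag D) f + cross A D f"
proof -
  have fin: "finite (offdiag A)" "finite (offdiag D)"
    using assms by (auto simp: offdiag_def intro: finite_subset[of _ "A \<times> A"] finite_subset[of _ "D \<times> D"])
  have "offdiag (A \<union> D) = (offdiag A \<union> offdiag D) \<union> (A \<times> D \<union> D \<times> A)"
    using assms by (auto simp: offdiag_def)
  moreover have "(offdiag A \<union> offdiag D) \<inter> (A \<times> D \<union> D \<times> A) = {}" "offdiag A \<inter> offdiag D = {}"
    "A \<times> D \<inter> D \<times> A = {}"
    using assms by (auto simp: offdiag_def)
  ultimately show ?thesis
    using assms fin by (simp add: moves_def cross_eq_moves sum.union_disjoint)
qed

lemma moves_offdiag_singleton: "moves (offdiag {a}) f = 0"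
proof -
  have "offdiag {a} = {}"
    by (auto simp: offdiag_def)
  then show ?thesis
    by (simp add: moves_def)
qed

lemma cross_Un_right:
  assumes "finite A" "finite B" "finite D" "B \<inter> D = {}"
  shows "cross A (B \<union> D) f = cross A B f + cross A D f"
  using assms by (simp add: cross_def sum.union_disjoint sum.distrib)

text \<open>A Pluecker relation: \<open>move i a \<circ> move k b\<close> is alternating in \<open>i, k\<close> and in \<open>a, b\<close>, so the
  twelve terms cancel in pairs.\<close>

lemma pair_relation:
  assumes m: "\<And>i j f. m i j f = move i j f + move j i f"
  shows "m i a (m k b f) + m i b (m k a f) + m i k (m a b f) = 0"
  unfolding m
  by (simp add: lin_add[OF lin_move] move_swap_Theta[of i a k b] move_swap_Theta[of i a b k]
      move_swap_Xi[of a i k b] move_swap_Xi[of a i b k] move_swap_Theta[of i b a k]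
      move_swap_Xi[of b i k a])

lemma cross_relation:
  "cross A {a} (cross D {b} f) + cross A {b} (cross D {a} f) + cross A D (cross {a} {b} f) = 0"
proof -
  define m where "m i j f = move i j f + move j i f" for i j f
  have lin: "lin (m i j)" for i j
    by (rule linI) (simp_all add: m_def lin_add[OF lin_move] lin_scale[OF lin_move]
        fun_space.scale_right_distrib)
  have cross: "cross A D f = (\<Sum>i\<in>A. \<Sum>k\<in>D. m i k f)" for A D f
    by (simp add: cross_def m_def)
  have "cross A {a} (cross D {b} f) + cross A {b} (cross D {a} f) + cross A D (cross {a} {b} f)
    = (\<Sum>i\<in>A. \<Sum>k\<in>D. m i a (m k b f) + m i b (m k a f) + m i k (m a b f))"
    by (simp add: cross lin_sum[OF lin] sum.distrib)
  also have "\<dots> = 0"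
    by (simp only: pair_relation[OF m_def] sum.neutral_const)
  finally show ?thesis .
qed

text \<open>Split every operator into the parts of \<open>A\<close> and \<open>D\<close> and the
  \<open>cross\<close> terms. All products containing the operator of \<open>A\<close> or
  \<open>D\<close> itself agree on both sides because these operators commute; what remains is
  exactly \<open>cross_relation\<close>.\<close>

lemma skein_relation_offdiag:
  fixes f :: ext
  assumes "finite A" "finite D" "A \<inter> D = {}" "a \<notin> A" "a \<notin> D" "b \<notin> A" "b \<notin> D" "a \<noteq> b"
  defines "r \<equiv> \<lambda>B. moves (offdiag B)"
  shows "r (insert a A) (r (insert b D) f) + r (insert b A) (r (insert a D) f)
      + r (A \<union> D) (r {a, b} f)
    = r A (r (insert a (insert b D)) f) + r D (r (insert a (insert b A)) f)"
proof -
  have ab: "r {a, b} g = cross {a} {b} g" for g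
    using moves_offdiag_Un[of "{a}" "{b}" g] assms
    by (simp add: moves_offdiag_singleton insert_commute)
  have one: "r (insert c S) g = r S g + cross S {c} g" if "finite S" "c \<notin> S" for S c g
    using moves_offdiag_Un[of S "{c}" g] that by (simp add: r_def moves_offdiag_singleton)
  have two: "r (insert a (insert b S)) g = r S g + cross {a} {b} g + (cross S {a} g + cross S {b} g)"
    if "finite S" "a \<notin> S" "b \<notin> S" for S g
    using moves_offdiag_Un[of S "{a, b}" g] cross_Un_right[of S "{b}" "{a}" g] that assms(8)
    by (simp add: ab[symmetric] add.commute) (simp add: r_def)
  have AD: "r (A \<union> D) g = r A g + r D g + cross A D g" for g
    using assms by (simp add: moves_offdiag_Un)
  have comm: "r D (r A g) = r A (r D g)" "cross X Y (r S g) = r S (cross X Y g)" for S X Y g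
    by (simp_all add: r_def moves_commute moves_cross_commute)
  have lin: "r S (g + h) = r S g + r S h" for S g h
    by (simp add: r_def lin_add[OF lin_moves])
  have fin: "finite (insert b A)" "finite (insert b D)"
    using assms by auto
  show ?thesis
    unfolding one[OF assms(1,4)] one[OF assms(2,5)] one[OF assms(1,6)] one[OF assms(2,7)]
      two[OF assms(1,4,6)] two[OF assms(2,5,7)] AD ab lin lin_add[OF lin_cross] comm
    using cross_relation[of A a D b f] by (simp add: algebra_simps)
qed

section \<open>From block operators to the fermions of set partitions\<close>

lemma monomial_sorted: "sorted_wrt (<) \<omega>s \<Longrightarrow> monomial \<omega>s = basis_vec (set \<omega>s)"
proof (induction \<omega>s)
  case Nil
  show ?case by (simp add: monomial_def ext_one_def)
next
  case (Cons v vs)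
  have v: "v \<notin> set vs"
    using Cons.prems by auto
  have b: "below v (insert v (set vs)) = 0"
    using Cons.prems by (auto simp: below_def)
  have "monomial (v # vs) U = basis_vec (insert v (set vs)) U" for U
  proof (cases "U = insert v (set vs)")
    case True
    then show ?thesis
      using v b Cons by (simp add: monomial_Cons ext_mult_gen basis_vec_def)
  next
    case False
    then have "v \<in> U \<Longrightarrow> U - {v} \<noteq> set vs"
      by auto
    with False show ?thesis
      using Cons by (simp add: monomial_Cons ext_mult_gen basis_vec_def)
  qed
  then show ?case by auto
qed

lemma F_empty: "F n {} = basis_vec (Theta ` {1..n})"
proof -
  have "sorted_wrt (<) (map Theta [1..<Suc n])"
    by (auto simp: sorted_wrt_map less_fermion_def simp del: upt_Suc
        intro: sorted_wrt_mono_rel[OF _ sorted_wrt_upt])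
  then have "monomial (map Theta [1..<Suc n]) = basis_vec (Theta ` {1..<Suc n})"
    by (simp only: monomial_sorted set_map set_upt)
  moreover have "{1..<Suc n} = {1..n}"
    by auto
  ultimately show ?thesis
    by (simp add: F_def del: upt_Suc)
qed

lemma F_insert:
  assumes "finite P" "B \<notin> P"
  shows "F n (insert B P) = rho B (F n P)"
proof -
  interpret comp_fun_commute rho
    by (rule comp_fun_commute_rho)
  show ?thesis
    using assms by (simp add: F_def)
qed

lemma F_insert_two:
  "finite P \<Longrightarrow> B \<notin> P \<Longrightarrow> C \<notin> P \<Longrightarrow> B \<noteq> C \<Longrightarrow> F n (P \<union> {B, C}) = rho B (rho C (F n P))"
  by (simp add: F_insert insert_commute)

lemma moves_offdiag: "moves (offdiag B) = (if card B > 1 then rho B else 0)" if "finite B"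
proof (cases "card B > 1")
  case True
  then show ?thesis by (simp add: rho_eq_moves rho_moves_def)
next
  case False
  with that have "B = {} \<or> (\<exists>b. B = {b})"
    by (metis One_nat_def card_0_eq card_1_singletonE less_one linorder_neqE_nat)
  then have "offdiag B = {}"
    by (auto simp: offdiag_def)
  then show ?thesis using False
    by (auto simp: moves_def fun_eq_iff)
qed

text \<open>The off-diagonal relation is applied to the product over the remaining blocks
  \<open>P\<close>. Only \<open>A\<close> and \<open>D\<close> standing alone can be singletons, and
  then the off-diagonal operator is 0; hence the two conditionals.\<close>

lemma F_skein:
  assumes "finite P" "finite A" "finite D" "A \<noteq> {}" "D \<noteq> {}" "A \<inter> D = {}"
    and ab: "a \<notin> A" "a \<notin> D" "b \<notin> A" "b \<notin> D" "a \<noteq> b"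
    and P: "\<And>X. X \<in> P \<Longrightarrow> X \<inter> (A \<union> D \<union> {a, b}) = {}"
  shows "F n (P \<union> {insert a A, insert b D}) + F n (P \<union> {insert b A, insert a D})
      + F n (P \<union> {A \<union> D, {a, b}})
    = (if card A > 1 then F n (P \<union> {A, insert a (insert b D)}) else 0)
      + (if card D > 1 then F n (P \<union> {D, insert a (insert b A)}) else 0)"
proof -
  have notin: "X \<notin> P" if "X \<noteq> {}" "X \<subseteq> A \<union> D \<union> {a, b}" for X
    using P[of X] that by blast
  have two: "F n (P \<union> {X, Y}) = rho X (rho Y (F n P))"
    if "X \<noteq> {}" "Y \<noteq> {}" "X \<inter> Y = {}" "X \<subseteq> A \<union> D \<union> {a, b}" "Y \<subseteq> A \<union> D \<union> {a, b}" for X Y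
    using that assms(1) by (intro F_insert_two notin) auto
  have big: "card (insert c S) > 1" if "finite S" "S \<noteq> {}" "c \<notin> S" for c S
    using that by (simp add: card_gt_0_iff)
  have cards: "card (insert a A) > 1" "card (insert b A) > 1" "card (insert a D) > 1"
    "card (insert b D) > 1" "card {a, b} > 1" "card (insert a (insert b D)) > 1"
    "card (insert a (insert b A)) > 1" 
    using assms big[of A] big[of D] big[of "insert b A" a] big[of "insert b D" a] by auto
  have AD: "card (A \<union> D) > 1"
    using assms(2-6) card_gt_0_iff[of A] card_gt_0_iff[of D] by (auto simp: card_Un_disjoint)
  have "rho (insert a A) (rho (insert b D) (F n P)) + rho (insert b A) (rho (insert a D) (F n P))
      + rho (A \<union> D) (rho {a, b} (F n P))
    = (if card A > 1 then rho A (rho (insert a (insert b D)) (F n P)) else 0)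
      + (if card D > 1 then rho D (rho (insert a (insert b A)) (F n P)) else 0)"
    using skein_relation_offdiag[OF assms(2,3,6) ab, of "F n P"] assms(2,3) cards AD
    by (simp add: moves_offdiag)
  moreover have "F n (P \<union> {insert a A, insert b D}) = rho (insert a A) (rho (insert b D) (F n P))"
    "F n (P \<union> {insert b A, insert a D}) = rho (insert b A) (rho (insert a D) (F n P))"
    "F n (P \<union> {A \<union> D, {a, b}}) = rho (A \<union> D) (rho {a, b} (F n P))"
    "F n (P \<union> {A, insert a (insert b D)}) = rho A (rho (insert a (insert b D)) (F n P))"
    "F n (P \<union> {D, insert a (insert b A)}) = rho D (rho (insert a (insert b A)) (F n P))"
    using assms by (intro two; blast)+
  ultimately show ?thesis by simp
qed

section \<open>Adjacent transpositions acting on the exterior algebra\<close>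

fun swap_gen :: "nat \<Rightarrow> fermion \<Rightarrow> fermion" where
  "swap_gen i (Theta j) = Theta (adj i j)"
| "swap_gen i (Xi j) = Xi (adj i j)"

text \<open>Exchanging the indices in a sorted monomial destroys the order only if both \<theta>
  with index \<open>i\<close> and \<open>Suc i\<close>, or both such \<xi>, occur. They are
  neighbours in the order, so each such pair costs one factor -1.\<close>

definition swap_sign :: "nat \<Rightarrow> fermion set \<Rightarrow> complex" where
  "swap_sign i U = (if Theta i \<in> U \<and> Theta (Suc i) \<in> U then - 1 else 1)
    * (if Xi i \<in> U \<and> Xi (Suc i) \<in> U then - 1 else 1)"

definition swap_op :: "nat \<Rightarrow> ext \<Rightarrow> ext" where
  "swap_op i f = (\<lambda>U. swap_sign i U * f (swap_gen i ` U))"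

lemma lin_swap_op: "lin (swap_op i)"
  by (rule linI) (auto simp: swap_op_def scale_def fun_eq_iff algebra_simps)

lemma swap_gen_involutive [simp]: "swap_gen i (swap_gen i v) = v"
  by (cases v) auto

lemma swap_gen_image_involutive [simp]: "swap_gen i ` swap_gen i ` U = U"
  by (simp add: image_image)

lemma inj_swap_gen: "inj (swap_gen i)"
  by (metis injI swap_gen_involutive)

lemma mem_swap_gen_image: "v \<in> swap_gen i ` U \<longleftrightarrow> swap_gen i v \<in> U"
  by (metis image_eqI image_iff swap_gen_involutive)

lemma swap_sign_square [simp]: "swap_sign i U * swap_sign i U = 1"
  by (simp add: swap_sign_def)

text \<open>Two exchanged generators can be separated by the condition of lying below
  \<open>v\<close> only if \<open>v\<close> is the larger of the two.\<close>

lemma below_swap_gen_image: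
  assumes "v \<noteq> Theta (Suc i)" "v \<noteq> Xi (Suc i)"
  shows "below v (swap_gen i ` U) = below v U"
proof -
  have "swap_gen i u < v \<longleftrightarrow> u < v" for u
    using assms by (cases u; cases v) (simp_all add: less_fermion_def transpose_def, linarith+)
  then have "{u \<in> swap_gen i ` U. u < v} = swap_gen i ` {u \<in> U. u < v}"
    by auto
  then show ?thesis
    by (simp add: below_def card_image inj_on_subset[OF inj_swap_gen])
qed

lemma below_Suc:
  assumes "finite U"
  shows "below (Theta (Suc k)) U = below (Theta k) U + (if Theta k \<in> U then 1 else 0)"
    and "below (Xi (Suc k)) U = below (Xi k) U + (if Xi k \<in> U then 1 else 0)"
proof -
  have *: "u < Theta (Suc k) \<longleftrightarrow> u = Theta k \<or> u < Theta k"
    "u < Xi (Suc k) \<longleftrightarrow> u = Xi k \<or> u < Xi k" for u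
    by (cases u; auto simp: less_fermion_def)+
  have "{u \<in> U. u < Theta (Suc k)}
      = (if Theta k \<in> U then insert (Theta k) {u \<in> U. u < Theta k} else {u \<in> U. u < Theta k})"
    "{u \<in> U. u < Xi (Suc k)}
      = (if Xi k \<in> U then insert (Xi k) {u \<in> U. u < Xi k} else {u \<in> U. u < Xi k})"
    by (auto simp: *)
  then show "below (Theta (Suc k)) U = below (Theta k) U + (if Theta k \<in> U then 1 else 0)"
    and "below (Xi (Suc k)) U = below (Xi k) U + (if Xi k \<in> U then 1 else 0)"
    using assms by (simp_all add: below_def)
qed

lemma swap_sign_remove:
  assumes "finite U" "swap_gen i v \<in> U"
  shows "(- 1) ^ below v (swap_gen i ` U) * swap_sign i U
    = (- 1) ^ below (swap_gen i v) U * swap_sign i (U - {swap_gen i v})"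
proof -
  consider k where "v = Theta k" "k \<noteq> i" "k \<noteq> Suc i" | k where "v = Xi k" "k \<noteq> i" "k \<noteq> Suc i"
    | "v = Theta i" | "v = Theta (Suc i)" | "v = Xi i" | "v = Xi (Suc i)"
    by (metis fermion.exhaust)
  then show ?thesis
    using assms by cases (simp_all add: below_swap_gen_image below_Suc mem_swap_gen_image
        swap_sign_def)
qed

text \<open>This is \<open>swap_sign_remove\<close> for the enlarged set: \<open>below\<close> does
  not count the generator itself, and \<open>swap_sign\<close> changes sides because it squares to
  1.\<close>

lemma swap_sign_insert:
  assumes "finite U" "swap_gen i v \<notin> U"
  shows "(- 1) ^ below v (swap_gen i ` U) * swap_sign i U
    = (- 1) ^ below (swap_gen i v) U * swap_sign i (insert (swap_gen i v) U)"
proof -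
  let ?V = "insert (swap_gen i v) U"
  have 1: "below v (swap_gen i ` ?V) = below v (swap_gen i ` U)"
    "below (swap_gen i v) ?V = below (swap_gen i v) U"
    unfolding below_def by (auto intro!: arg_cong[where f = card])
  have "(- 1) ^ below v (swap_gen i ` U) * swap_sign i ?V
    = (- 1) ^ below (swap_gen i v) U * swap_sign i U"
    using swap_sign_remove[of ?V i v] assms 1 by simp
  then have "(- 1) ^ below v (swap_gen i ` U) * (swap_sign i ?V * swap_sign i ?V) * swap_sign i U
    = (- 1) ^ below (swap_gen i v) U * (swap_sign i U * swap_sign i U) * swap_sign i ?V"
    by (simp only: mult.assoc mult.left_commute mult.commute)
  then show ?thesis by simp
qed

text \<open>Exchanging indices is an automorphism of the exterior algebra, so it carries
  \<open>move\<close> to \<open>move\<close> with exchanged indices. On coefficients,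
  \<open>swap_sign_remove\<close> accounts for the \<xi> taken out and
  \<open>swap_sign_insert\<close> for the \<theta> put in.\<close>

lemma swap_op_move: "swap_op i (move k l f) = move (adj i k) (adj i l) (swap_op i f)"
proof
  fix U
  define V where "V = swap_gen i ` U"
  show "swap_op i (move k l f) U = move (adj i k) (adj i l) (swap_op i f) U"
  proof (cases "finite U \<and> Xi (adj i k) \<in> U \<and> Theta (adj i l) \<notin> U")
    case False
    then show ?thesis
      by (auto simp: swap_op_def move_apply mem_swap_gen_image finite_image_iff
          inj_on_subset[OF inj_swap_gen])
  next
    case True
    let ?W = "U - {Xi (adj i k)}"
    have V: "finite V" "Xi k \<in> V" "Theta l \<notin> V"
      using True by (auto simp: V_def mem_swap_gen_image)
    have img: "swap_gen i ` ?W = V - {Xi k}"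
      "swap_gen i ` insert (Theta (adj i l)) ?W = insert (Theta l) (V - {Xi k})"
      by (auto simp: V_def image_set_diff[OF inj_swap_gen])
    have 1: "(- 1) ^ below (Xi k) V * swap_sign i U = (- 1) ^ below (Xi (adj i k)) U * swap_sign i ?W"
      using swap_sign_remove[of U i "Xi k"] True by (simp add: V_def)
    have 2: "(- 1) ^ below (Theta l) (V - {Xi k}) * swap_sign i ?W
        = (- 1) ^ below (Theta (adj i l)) ?W * swap_sign i (insert (Theta (adj i l)) ?W)"
      using swap_sign_insert[of ?W i "Theta l"] True by (simp add: img)
    have "swap_op i (move k l f) U
        = ((- 1) ^ below (Xi k) V * swap_sign i U) * (- 1) ^ below (Theta l) V
          * f (insert (Theta l) (V - {Xi k}))"
      using V by (simp add: swap_op_def move_apply V_def[symmetric] power_add)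
    also have "\<dots> = (- 1) ^ below (Xi (adj i k)) U
          * ((- 1) ^ below (Theta l) (V - {Xi k}) * swap_sign i ?W)
          * f (insert (Theta l) (V - {Xi k}))"
      by (simp add: 1 below_Theta_remove_Xi)
    also have "\<dots> = move (adj i k) (adj i l) (swap_op i f) U"
      unfolding 2 using True
      by (simp add: swap_op_def move_apply power_add below_Theta_remove_Xi img)
    finally show ?thesis .
  qed
qed

lemma rho_moves_image:
  assumes "inj w" "finite B" "B \<noteq> {}"
  shows "rho_moves (w ` B) = map_prod w w ` rho_moves B"
proof (cases "card B > 1")
  case True
  moreover have "offdiag (w ` B) = map_prod w w ` offdiag B"
    using assms(1) by (auto simp: offdiag_def inj_eq)
  ultimately show ?thesis
    using assms by (simp add: rho_moves_def card_image inj_on_subset[OF assms(1)])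
next
  case False
  with assms obtain b where "B = {b}"
    by (metis One_nat_def card_0_eq card_1_singletonE less_one linorder_neqE_nat)
  then show ?thesis by (simp add: rho_moves_def)
qed

lemma swap_op_rho:
  assumes "finite B" "B \<noteq> {}"
  shows "swap_op i (rho B f) = rho (adj i ` B) (swap_op i f)"
proof -
  have inj: "inj (adj i)" by simp
  have "swap_op i (rho B f) = (\<Sum>p\<in>rho_moves B. move (adj i (fst p)) (adj i (snd p)) (swap_op i f))"
    by (simp add: rho_eq_moves moves_def split_def lin_sum[OF lin_swap_op] swap_op_move)
  also have "\<dots> = (\<Sum>p\<in>map_prod (adj i) (adj i) ` rho_moves B. move (fst p) (snd p) (swap_op i f))"
    by (subst sum.reindex) (auto intro: inj_on_subset[OF prod.inj_map])
  also have "\<dots> = rho (adj i ` B) (swap_op i f)"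
    by (simp add: rho_eq_moves moves_def split_def rho_moves_image[OF inj assms])
  finally show ?thesis .
qed

lemma swap_op_F_empty:
  assumes "i \<in> {1..<n}"
  shows "swap_op i (F n {}) = - F n {}"
proof
  fix U
  let ?S = "Theta ` {1..n}"
  have "adj i ` {1..n} = {1..n}"
    using assms by (intro permutes_image permutes_swap_id) auto
  then have "Theta ` adj i ` {1..n} = ?S"
    by (rule arg_cong)
  then have S: "swap_gen i ` ?S = ?S"
    by (simp add: image_image)
  show "swap_op i (F n {}) U = (- F n {}) U"
  proof (cases "U = ?S")
    case True
    have "swap_sign i ?S = - 1"
      using assms by (auto simp: swap_sign_def)
    with True S show ?thesis
      by (simp add: F_empty swap_op_def basis_vec_def)
  next
    case False
    then have "swap_gen i ` U \<noteq> ?S"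
      using S by (metis swap_gen_image_involutive)
    with False show ?thesis
      by (simp add: F_empty swap_op_def basis_vec_def)
  qed
qed

lemma swap_op_F:
  assumes "i \<in> {1..<n}" "finite P" "\<And>B. B \<in> P \<Longrightarrow> finite B \<and> B \<noteq> {}"
  shows "swap_op i (F n P) = - F n (perm_part (adj i) P)"
  using assms(2,3)
proof (induction P)
  case empty
  then show ?case
    using swap_op_F_empty[OF assms(1)] by (simp add: perm_part_def)
next
  case (insert B P)
  have "adj i ` B \<notin> perm_part (adj i) P"
    using insert.hyps by (auto simp: perm_part_def inj_image_eq_iff)
  moreover have "finite (perm_part (adj i) P)"
    using insert.hyps by (simp add: perm_part_def)
  moreover have "perm_part (adj i) (insert B P) = insert (adj i ` B) (perm_part (adj i) P)"
    by (simp add: perm_part_def)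
  moreover have "swap_op i (F n (insert B P)) = - rho (adj i ` B) (F n (perm_part (adj i) P))"
    using insert by (simp only: F_insert swap_op_rho lin_neg[OF lin_rho] insert_iff simp_thms)
  ultimately show ?case
    by (simp only: F_insert[of "perm_part (adj i) P"] not_False_eq_True)
qed

section \<open>Blocks of set partitions\<close>

lemma finite_Parts: "finite (Parts n)"
  unfolding Parts_def by (rule finitely_many_partition_on) simp

lemma finite_NC: "finite (NC n)"
  by (rule finite_subset[OF _ finite_Parts[of n]]) (auto simp: NC_def)

lemma Parts_D:
  assumes "\<pi> \<in> Parts n"
  shows "partition_on {1..n} \<pi>" "\<Union>\<pi> = {1..n}" "disjoint \<pi>" "finite \<pi>"
    and "\<And>B. B \<in> \<pi> \<Longrightarrow> finite B" "\<And>B. B \<in> \<pi> \<Longrightarrow> B \<noteq> {}" "\<And>B. B \<in> \<pi> \<Longrightarrow> B \<subseteq> {1..n}"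
proof -
  show p: "partition_on {1..n} \<pi>"
    using assms by (simp add: Parts_def)
  then show u: "\<Union>\<pi> = {1..n}" and "disjoint \<pi>"
    by (auto simp: partition_on_def)
  show "finite \<pi>"
    using p by (rule finite_elements[rotated]) simp
  show s: "B \<subseteq> {1..n}" if "B \<in> \<pi>" for B
    using u that by auto
  show "finite B" if "B \<in> \<pi>" for B
    using s[OF that] by (rule finite_subset) simp
  show "B \<noteq> {}" if "B \<in> \<pi>" for B
    using p that by (auto simp: partition_on_def)
qed

lemma Parts_eq_block:
  assumes "\<pi> \<in> Parts n" "B \<in> \<pi>" "C \<in> \<pi>" "x \<in> B" "x \<in> C"
  shows "B = C"
  using Parts_D(3)[OF assms(1)] assms(2-) by (auto simp: disjoint_def)

lemma block_of_eq:
  assumes "\<pi> \<in> Parts n" "B \<in> \<pi>" "x \<in> B"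
  shows "block_of \<pi> x = B"
  unfolding block_of_def
proof (rule the_equality)
  show "C = B" if "C \<in> \<pi> \<and> x \<in> C" for C
    using Parts_eq_block[OF assms(1)] that assms(2,3) by blast
qed (use assms in simp)

lemma block_of_mem:
  assumes "\<pi> \<in> Parts n" "x \<in> {1..n}"
  shows "block_of \<pi> x \<in> \<pi>" "x \<in> block_of \<pi> x"
proof -
  obtain B where "B \<in> \<pi>" "x \<in> B"
    using Parts_D(2)[OF assms(1)] assms(2) by blast
  then show "block_of \<pi> x \<in> \<pi>" "x \<in> block_of \<pi> x"
    using block_of_eq[OF assms(1)] by auto
qed

lemma Min_block: "\<pi> \<in> Parts n \<Longrightarrow> B \<in> \<pi> \<Longrightarrow> Min B \<in> B"
  and Max_block: "\<pi> \<in> Parts n \<Longrightarrow> B \<in> \<pi> \<Longrightarrow> Max B \<in> B"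
  by (simp_all add: Parts_D)

lemma inj_on_Min: "\<pi> \<in> Parts n \<Longrightarrow> inj_on Min \<pi>"
  and inj_on_Max: "\<pi> \<in> Parts n \<Longrightarrow> inj_on Max \<pi>"
  by (metis inj_onI Min_block Max_block Parts_eq_block)+

section \<open>A coefficient detecting the extremal elements of the blocks\<close>

lemma rho_moves_mem:
  assumes "(i, j) \<in> rho_moves B" "finite B" "B \<noteq> {}"
  shows "i \<in> B" "j \<in> B"
proof -
  have "i \<in> B \<and> j \<in> B"
  proof (cases "card B > 1")
    case True
    then show ?thesis using assms by (auto simp: rho_moves_def offdiag_def)
  next
    case False
    with assms obtain b where "B = {b}"
      by (metis One_nat_def card_0_eq card_1_singletonE less_one linorder_neqE_nat)
    then show ?thesis using assms by (auto simp: rho_moves_def)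
  qed
  then show "i \<in> B" "j \<in> B" by auto
qed

lemma finite_rho_moves: "finite B \<Longrightarrow> finite (rho_moves B)"
  by (auto simp: rho_moves_def offdiag_def intro: finite_subset[of _ "B \<times> B"])

text \<open>Each \<open>rho B\<close> removes one \<theta> and adds one \<xi>, both with index in
  \<open>B\<close>. The last conjunct serves the induction: a block not yet processed still has all
  its \<theta> and no \<xi>.\<close>

lemma F_support:
  assumes "finite P" "\<And>B. B \<in> P \<Longrightarrow> B \<noteq> {} \<and> B \<subseteq> {1..n}" "disjoint P" "F n P U \<noteq> 0"
  shows "(\<forall>B\<in>P. \<exists>i\<in>B. \<forall>x\<in>B. Xi x \<in> U \<longleftrightarrow> x = i) \<and>
    (\<forall>B\<in>P. \<exists>j\<in>B. \<forall>x\<in>B. Theta x \<notin> U \<longleftrightarrow> x = j) \<and>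
    (\<forall>x. x \<notin> \<Union>P \<longrightarrow> Xi x \<notin> U \<and> (Theta x \<in> U \<longleftrightarrow> x \<in> {1..n}))"
  using assms
proof (induction P arbitrary: U)
  case empty
  then show ?case
    by (auto simp: F_empty basis_vec_def split: if_splits)
next
  case (insert B P)
  have "B \<inter> C = {}" if "C \<in> P" for C
    using disjointD[OF insert.prems(2), of B C] insert.hyps(2) that by blast
  then have B: "B \<noteq> {}" "B \<inter> \<Union>P = {}" "B \<subseteq> {1..n}"
    using insert.prems(1)[of B] by auto
  then have "finite B"
    using finite_subset by blast
  note B = this B
  have "(\<Sum>p\<in>rho_moves B. move (fst p) (snd p) (F n P) U) \<noteq> 0"
    using insert.prems(3) insert.hyps
    by (simp add: F_insert rho_eq_moves moves_def sum_apply split_def)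
  then obtain i j where ij: "(i, j) \<in> rho_moves B" "move i j (F n P) U \<noteq> 0"
    by (metis (no_types, lifting) sum.neutral prod.collapse)
  note mem = rho_moves_mem[OF ij(1) B(1,2)]
  define V where "V = insert (Theta j) (U - {Xi i})"
  have U: "Xi i \<in> U" "Theta j \<notin> U" "F n P V \<noteq> 0"
    using ij(2) by (auto simp: move_apply V_def split: if_splits)
  have V: "Xi x \<in> V \<longleftrightarrow> Xi x \<in> U \<and> x \<noteq> i" "Theta x \<in> V \<longleftrightarrow> Theta x \<in> U \<or> x = j" for x
    by (auto simp: V_def)
  have IH: "(\<forall>B\<in>P. \<exists>i\<in>B. \<forall>x\<in>B. Xi x \<in> V \<longleftrightarrow> x = i) \<and>
    (\<forall>B\<in>P. \<exists>j\<in>B. \<forall>x\<in>B. Theta x \<notin> V \<longleftrightarrow> x = j) \<and>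
    (\<forall>x. x \<notin> \<Union>P \<longrightarrow> Xi x \<notin> V \<and> (Theta x \<in> V \<longleftrightarrow> x \<in> {1..n}))"
    using insert.prems(1,2) by (intro insert.IH U(3)) (auto simp: disjoint_def)
  have "x \<in> {1..n} \<and> x \<notin> \<Union>P" if "x \<in> B" for x
    using that B(3,4) by blast
  then have new: "\<forall>x\<in>B. Xi x \<in> U \<longleftrightarrow> x = i" "\<forall>x\<in>B. Theta x \<notin> U \<longleftrightarrow> x = j"
    using IH V U(1,2) by metis+
  have old: "Xi x \<in> V \<longleftrightarrow> Xi x \<in> U" "Theta x \<in> V \<longleftrightarrow> Theta x \<in> U" if "x \<notin> B" for x
    using that mem V by auto
  have "x \<notin> B" if "C \<in> P" "x \<in> C" for x C
    using that B(3) by blast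
  then show ?case
    using IH new mem old by (intro conjI) (simp_all, metis+)
qed

definition extremal :: "nat \<Rightarrow> setpart \<Rightarrow> fermion set" where
  "extremal n P = Xi ` Min ` P \<union> Theta ` ({1..n} - Max ` P)"

text \<open>Inside a block \<open>B\<close>, the set \<open>extremal\<close> has its only \<xi> at
  \<open>Min B\<close> and lacks only the \<theta> at \<open>Max B\<close>. So a single summand of
  \<open>rho B\<close> contributes, no cancellation occurs, and the coefficient passes up to sign to
  the remaining blocks.\<close>

lemma F_extremal_nonzero:
  assumes "finite P" "\<And>B. B \<in> P \<Longrightarrow> B \<noteq> {} \<and> B \<subseteq> {1..n}" "disjoint P"
  shows "F n P (extremal n P) \<noteq> 0"
  using assms
proof (induction P)
  case empty
  then show ?case
    by (simp add: F_empty extremal_def basis_vec_def)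
next
  case (insert B P)
  let ?U = "extremal n (insert B P)" and ?b = "(Min B, Max B)"
  have "B \<inter> C = {}" if "C \<in> P" for C
    using disjointD[OF insert.prems(2), of B C] insert.hyps(2) that by blast
  then have B: "B \<noteq> {}" "B \<inter> \<Union>P = {}" "B \<subseteq> {1..n}"
    using insert.prems(1)[of B] by auto
  then have "finite B"
    using finite_subset by blast
  note B = this B
  have ext: "Min C \<in> C" "Max C \<in> C" if "C \<in> insert B P" for C
    using insert.prems(1)[OF that] finite_subset[of C "{1..n}"] by auto
  have notin: "x \<notin> Min ` P" "x \<notin> Max ` P" if "x \<in> B" for x
    using that B(3) ext by blast+
  have b: "?b \<in> rho_moves B"
  proof (cases "card B > 1")
    case True
    then have "Min B \<noteq> Max B"
      using B(1,2) by (metis card_le_Suc0_iff_eq Max_ge Min_le One_nat_def le_antisym not_less)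
    with True show ?thesis
      using ext[of B] by (auto simp: rho_moves_def offdiag_def)
  next
    case False
    with B obtain b where "B = {b}"
      by (metis One_nat_def card_0_eq card_1_singletonE less_one linorder_neqE_nat)
    then show ?thesis by (auto simp: rho_moves_def)
  qed
  have zero: "move i j (F n P) ?U = 0" if "(i, j) \<in> rho_moves B" "(i, j) \<noteq> ?b" for i j
  proof -
    have "i \<in> B" "j \<in> B"
      using rho_moves_mem[OF that(1) B(1,2)] .
    then have "Xi i \<notin> ?U \<or> Theta j \<in> ?U"
      using that(2) notin B(4) by (auto simp: extremal_def)
    then show ?thesis
      by (auto simp: move_apply)
  qed
  have "F n (insert B P) ?U = (\<Sum>p\<in>rho_moves B. move (fst p) (snd p) (F n P) ?U)"
    using insert.hyps by (simp add: F_insert rho_eq_moves moves_def sum_apply split_def)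
  also have "\<dots> = move (Min B) (Max B) (F n P) ?U"
  proof -
    have "(\<Sum>p\<in>rho_moves B - {?b}. move (fst p) (snd p) (F n P) ?U) = 0"
      by (rule sum.neutral) (use zero in \<open>metis DiffE insertI1 prod.collapse\<close>)
    then show ?thesis
      by (simp add: sum.remove[OF finite_rho_moves[OF B(1)] b])
  qed
  finally have *: "F n (insert B P) ?U = move (Min B) (Max B) (F n P) ?U" .
  have "insert (Theta (Max B)) (?U - {Xi (Min B)}) = extremal n P"
    using notin[of "Min B"] notin[of "Max B"] ext[of B] B(4) by (auto simp: extremal_def)
  moreover have "finite ?U" "Xi (Min B) \<in> ?U" "Theta (Max B) \<notin> ?U"
    using insert.hyps by (auto simp: extremal_def)
  moreover have "F n P (extremal n P) \<noteq> 0"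
    using insert.prems by (intro insert.IH) (auto simp: disjoint_def)
  ultimately show ?case
    unfolding * by (simp add: move_apply)
qed

definition width :: "setpart \<Rightarrow> int" where
  "width \<pi> = (\<Sum>B\<in>\<pi>. int (Max B)) - (\<Sum>B\<in>\<pi>. int (Min B))"

text \<open>Since \<open>S\<close> meets every block exactly in the point chosen by
  \<open>c\<close>, and blocks are disjoint and cover \<open>{1..n}\<close>, the map
  \<open>c\<close> is a bijection from the blocks to \<open>S\<close>.\<close>

lemma sum_transversal:
  assumes "\<pi> \<in> Parts n" "S \<subseteq> {1..n}" "\<And>B. B \<in> \<pi> \<Longrightarrow> c B \<in> B \<and> (\<forall>x\<in>B. x \<in> S \<longleftrightarrow> x = c B)"
  shows "c ` \<pi> = S" "(\<Sum>B\<in>\<pi>. g (c B)) = sum g S"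
proof -
  show S: "c ` \<pi> = S"
  proof (intro equalityI subsetI)
    fix x assume "x \<in> S"
    then obtain B where "B \<in> \<pi>" "x \<in> B"
      using assms(1,2) block_of_mem by blast
    with assms(3)[of B] \<open>x \<in> S\<close> show "x \<in> c ` \<pi>" by auto
  qed (use assms(3) in auto)
  have "inj_on c \<pi>"
    using assms(1,3) by (metis inj_onI Parts_eq_block)
  then show "(\<Sum>B\<in>\<pi>. g (c B)) = sum g S"
    unfolding S[symmetric] by (simp add: sum.reindex)
qed

lemma F_extremal_width:
  assumes \<pi>: "\<pi> \<in> Parts n" and \<rho>: "\<rho> \<in> Parts n" and nz: "F n \<rho> (extremal n \<pi>) \<noteq> 0"
  shows "width \<pi> \<le> width \<rho>"
    and "width \<pi> = width \<rho> \<Longrightarrow> Min ` \<rho> = Min ` \<pi> \<and> Max ` \<rho> = Max ` \<pi>"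
proof -
  let ?U = "extremal n \<pi>"
  have sub: "Min ` \<pi> \<subseteq> {1..n}" "Max ` \<pi> \<subseteq> {1..n}"
    using Min_block[OF \<pi>] Max_block[OF \<pi>] Parts_D(7)[OF \<pi>] by blast+
  have U: "Xi x \<in> ?U \<longleftrightarrow> x \<in> Min ` \<pi>" "x \<in> {1..n} \<Longrightarrow> Theta x \<notin> ?U \<longleftrightarrow> x \<in> Max ` \<pi>" for x
    by (auto simp: extremal_def)
  note supp = F_support[OF Parts_D(4)[OF \<rho>] conjI[OF Parts_D(6,7)[OF \<rho>]] Parts_D(3)[OF \<rho>] nz]
  \<comment> \<open>\<open>f B\<close> is the one minimum of a block of \<pi> that lies in the block
    \<open>B\<close> of \<rho>; \<open>g B\<close> below plays the same role for the maxima.\<close>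
  obtain f where f: "f B \<in> B \<and> (\<forall>x\<in>B. x \<in> Min ` \<pi> \<longleftrightarrow> x = f B)" if "B \<in> \<rho>" for B
    using supp unfolding U(1) Bex_def by metis
  have "\<exists>j\<in>B. \<forall>x\<in>B. x \<in> Max ` \<pi> \<longleftrightarrow> x = j" if "B \<in> \<rho>" for B
    using supp that U(2) Parts_D(7)[OF \<rho> that] by (meson subsetD)
  then obtain g where g: "g B \<in> B \<and> (\<forall>x\<in>B. x \<in> Max ` \<pi> \<longleftrightarrow> x = g B)" if "B \<in> \<rho>" for B
    by metis
  note tf = sum_transversal[OF \<rho> sub(1) f] and tg = sum_transversal[OF \<rho> sub(2) g]
  \<comment> \<open>The width of \<pi> becomes a sum over the blocks of \<rho>, so the two widths
    can be compared block by block.\<close>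
  have w: "width \<pi> = (\<Sum>B\<in>\<rho>. int (g B)) - (\<Sum>B\<in>\<rho>. int (f B))"
    using tf(2)[of int] tg(2)[of int] inj_on_Min[OF \<pi>] inj_on_Max[OF \<pi>]
    by (simp add: width_def sum.reindex)
  have le: "Min B \<le> f B" "g B \<le> Max B" if "B \<in> \<rho>" for B
    using f[OF that] g[OF that] Parts_D(5)[OF \<rho> that] by auto
  then have sle: "(\<Sum>B\<in>\<rho>. int (Min B)) \<le> (\<Sum>B\<in>\<rho>. int (f B))"
    "(\<Sum>B\<in>\<rho>. int (g B)) \<le> (\<Sum>B\<in>\<rho>. int (Max B))"
    by (auto intro!: sum_mono)
  then show "width \<pi> \<le> width \<rho>"
    by (simp add: w width_def[of \<rho>])
  assume "width \<pi> = width \<rho>"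
  with sle have eq: "(\<Sum>B\<in>\<rho>. int (Min B)) = (\<Sum>B\<in>\<rho>. int (f B))"
    "(\<Sum>B\<in>\<rho>. int (g B)) = (\<Sum>B\<in>\<rho>. int (Max B))"
    by (auto simp: w width_def[of \<rho>])
  have "Min B = f B" "g B = Max B" if "B \<in> \<rho>" for B
    using sum_mono_inv[OF eq(1) _ that Parts_D(4)[OF \<rho>]]
      sum_mono_inv[OF eq(2) _ that Parts_D(4)[OF \<rho>]] le by auto
  then show "Min ` \<rho> = Min ` \<pi> \<and> Max ` \<rho> = Max ` \<pi>"
    using tf(1) tg(1) by auto
qed

section \<open>Linear independence\<close>

abbreviation block_min :: "setpart \<Rightarrow> nat \<Rightarrow> nat" where
  "block_min \<pi> x \<equiv> Min (block_of \<pi> x)"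

text \<open>Scanning from left to right, an element that does not open a block has to join the block
  opened last among those not yet closed.\<close>

lemma block_min_noncrossing:
  assumes "\<pi> \<in> NC n" "x \<in> {1..n}" "x \<notin> Min ` \<pi>"
  shows "block_min \<pi> x =
    Max {m \<in> Min ` \<pi>. m < x \<and> \<not> (\<exists>y<x. y \<in> Max ` \<pi> \<and> block_min \<pi> y = m)}"
    (is "_ = Max ?S")
proof -
  have \<pi>: "\<pi> \<in> Parts n" and nc: "noncrossing \<pi>"
    using assms(1) by (auto simp: NC_def)
  define B where "B = block_of \<pi> x"
  have B: "B \<in> \<pi>" "x \<in> B"
    using block_of_mem[OF \<pi> assms(2)] by (auto simp: B_def)
  have lt: "Min B < x"
    using B assms(3) Parts_D(5)[OF \<pi> B(1)] by (metis Min_le imageI le_neq_implies_less)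
  \<comment> \<open>An element \<open>y < x\<close> that is a block maximum with
    \<open>block_min \<pi> y = m\<close> says that the block opened at \<open>m\<close> is closed
    before \<open>x\<close>. So \<open>?S\<close> consists of the minima of the blocks still open at
    \<open>x\<close>.\<close>
  have closed: "block_of \<pi> (Max C) = C" if "C \<in> \<pi>" for C
    using block_of_eq[OF \<pi> that Max_block[OF \<pi> that]] .
  have "Max ?S = Min B"
  proof (rule Max_eqI)
    show "finite ?S"
      using Parts_D(4)[OF \<pi>] by auto
    have "\<not> (\<exists>y<x. y \<in> Max ` \<pi> \<and> block_min \<pi> y = Min B)"
    proof
      assume "\<exists>y<x. y \<in> Max ` \<pi> \<and> block_min \<pi> y = Min B"
      then obtain C where C: "Max C < x" "C \<in> \<pi>" "Min C = Min B"
        using closed by force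
      then have "C = B"
        using inj_on_Min[OF \<pi>] B(1) by (auto dest: inj_onD)
      with C(1) B show False
        using Parts_D(5)[OF \<pi> B(1)] by (meson Max_ge leD)
    qed
    with lt B(1) show "Min B \<in> ?S" by auto
  next
    fix m assume m: "m \<in> ?S"
    then obtain C where C: "C \<in> \<pi>" "m = Min C" by auto
    show "m \<le> Min B"
    proof (rule ccontr)
      assume *: "\<not> m \<le> Min B"
      with C have "C \<noteq> B" by auto
      have "\<not> Max C < x"
        using m C closed by auto
      moreover have "Max C \<noteq> x"
        using \<open>C \<noteq> B\<close> B C Max_block[OF \<pi> C(1)] Parts_eq_block[OF \<pi>] by metis
      ultimately have "x < Max C" by auto
      \<comment> \<open>A block \<open>C\<close> opened after \<open>B\<close> and still open at
        \<open>x\<close> would cross it at \<open>Min B < m < x < Max C\<close>.\<close>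
      then have "\<exists>D\<in>\<pi>. {Min B, m, x, Max C} \<subseteq> D"
        using nc * m C B Min_block[OF \<pi>] Max_block[OF \<pi>] unfolding noncrossing_def
        by (smt (verit) mem_Collect_eq not_le)
      then obtain D where "D \<in> \<pi>" "x \<in> D" "m \<in> D" by auto
      then show False
        using \<open>C \<noteq> B\<close> B C Min_block[OF \<pi> C(1)] Parts_eq_block[OF \<pi>] by metis
    qed
  qed
  then show ?thesis by (simp add: B_def)
qed

lemma block_min_Min:
  assumes "\<pi> \<in> Parts n" "x \<in> Min ` \<pi>"
  shows "block_min \<pi> x = x"
proof -
  from assms(2) obtain B where "B \<in> \<pi>" "x = Min B" by auto
  then show ?thesis
    using block_of_eq[OF assms(1) _ Min_block[OF assms(1)]] by simp
qed

lemma Parts_eq_fibres: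
  assumes "\<pi> \<in> Parts n"
  shows "\<pi> = (\<lambda>m. {x \<in> {1..n}. block_min \<pi> x = m}) ` Min ` \<pi>"
proof -
  have "{x \<in> {1..n}. block_min \<pi> x = Min B} = B" if "B \<in> \<pi>" for B
  proof (intro equalityI subsetI)
    fix x assume "x \<in> {x \<in> {1..n}. block_min \<pi> x = Min B}"
    then show "x \<in> B"
      using block_of_mem[OF assms] inj_onD[OF inj_on_Min[OF assms] _ _ that] by force
  qed (use that assms block_of_eq Parts_D(7) in blast)
  then show ?thesis
    by (auto simp: image_image)
qed

text \<open>\<open>block_min_noncrossing\<close> is a recursion for \<open>block_min\<close>: its
  right side involves only the sets of minima and maxima and the values at smaller elements. Hence
  \<open>block_min\<close> agrees for both partitions, and its fibres are the blocks.\<close>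

lemma NC_eqI:
  assumes \<pi>: "\<pi> \<in> NC n" and \<rho>: "\<rho> \<in> NC n" and eq: "Min ` \<pi> = Min ` \<rho>" "Max ` \<pi> = Max ` \<rho>"
  shows "\<pi> = \<rho>"
proof -
  have P: "\<pi> \<in> Parts n" "\<rho> \<in> Parts n"
    using \<pi> \<rho> by (auto simp: NC_def)
  have "block_min \<pi> x = block_min \<rho> x" if "x \<in> {1..n}" for x
    using that
  proof (induction x rule: less_induct)
    case (less x)
    show ?case
    proof (cases "x \<in> Min ` \<pi>")
      case True
      then show ?thesis
        using block_min_Min[OF P(1), of x] block_min_Min[OF P(2), of x] eq by simp
    next
      case False
      have "Max ` \<pi> \<subseteq> {1..n}"
        using Max_block[OF P(1)] Parts_D(7)[OF P(1)] by blast
      then have "(\<exists>y<x. y \<in> Max ` \<pi> \<and> block_min \<pi> y = m)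
          \<longleftrightarrow> (\<exists>y<x. y \<in> Max ` \<rho> \<and> block_min \<rho> y = m)" for m
        using less.IH eq(2) by (metis subsetD)
      then show ?thesis
        using block_min_noncrossing[OF \<pi> less.prems] block_min_noncrossing[OF \<rho> less.prems]
          False eq(1) by simp
    qed
  qed
  then have "(\<lambda>m. {x \<in> {1..n}. block_min \<pi> x = m}) = (\<lambda>m. {x \<in> {1..n}. block_min \<rho> x = m})"
    by auto
  then show ?thesis
    using Parts_eq_fibres[OF P(1)] Parts_eq_fibres[OF P(2)] eq(1) by metis
qed

text \<open>The matrix with entries \<open>F n \<rho> (extremal n \<pi>)\<close> is triangular with respect to the width.\<close>

lemma F_NC_independent:
  assumes "c \<in> free_space (NC n)" "(\<Sum>\<mu>\<in>NC n. scale (c \<mu>) (F n \<mu>)) = 0"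
  shows "c = 0"
proof (rule ccontr)
  assume "c \<noteq> 0"
  define S where "S = {\<mu> \<in> NC n. c \<mu> \<noteq> 0}"
  have "S \<noteq> {}"
    using \<open>c \<noteq> 0\<close> assms(1) by (auto simp: S_def free_space_def fun_eq_iff)
  moreover have "finite S"
    using finite_NC[of n] by (auto simp: S_def)
  ultimately have "Max (width ` S) \<in> width ` S" "\<And>\<nu>. \<nu> \<in> S \<Longrightarrow> width \<nu> \<le> Max (width ` S)"
    by auto
  \<comment> \<open>With \<mu> of maximal width in the support of \<open>c\<close>, any other \<nu>
    in the support with a nonzero coefficient at \<open>extremal n \<mu>\<close> would have the same
    width as \<mu>, hence the same minima and maxima, and so equal \<mu>.\<close>
  then obtain \<mu> where \<mu>: "\<mu> \<in> S" and max: "\<And>\<nu>. \<nu> \<in> S \<Longrightarrow> width \<nu> \<le> width \<mu>"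
    by force
  have P: "\<mu> \<in> NC n" "\<mu> \<in> Parts n"
    using \<mu> by (auto simp: S_def NC_def)
  have zero: "c \<nu> * F n \<nu> (extremal n \<mu>) = 0" if \<nu>: "\<nu> \<in> NC n" "\<nu> \<noteq> \<mu>" for \<nu>
  proof (rule ccontr)
    assume *: "c \<nu> * F n \<nu> (extremal n \<mu>) \<noteq> 0"
    then have "\<nu> \<in> S" using \<nu> by (auto simp: S_def)
    from * have nz: "F n \<nu> (extremal n \<mu>) \<noteq> 0" by simp
    have "\<nu> \<in> Parts n" using \<nu> by (simp add: NC_def)
    from F_extremal_width[OF P(2) this nz] max[OF \<open>\<nu> \<in> S\<close>]
    have "Min ` \<nu> = Min ` \<mu>" "Max ` \<nu> = Max ` \<mu>" by auto
    then show False using NC_eqI[OF \<nu>(1) P(1)] \<nu>(2) by simp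
  qed
  have "0 = (\<Sum>\<nu>\<in>NC n. scale (c \<nu>) (F n \<nu>)) (extremal n \<mu>)"
    by (simp add: assms(2))
  also have "\<dots> = (\<Sum>\<nu>\<in>NC n. c \<nu> * F n \<nu> (extremal n \<mu>))"
    by (simp add: sum_apply scale_def)
  also have "\<dots> = c \<mu> * F n \<mu> (extremal n \<mu>)"
  proof -
    have "(\<Sum>\<nu>\<in>NC n - {\<mu>}. c \<nu> * F n \<nu> (extremal n \<mu>)) = 0"
      by (rule sum.neutral) (use zero in blast)
    then show ?thesis
      by (simp add: sum.remove[OF finite_NC P(1)])
  qed
  finally have "F n \<mu> (extremal n \<mu>) = 0"
    using \<mu> by (simp add: S_def)
  moreover have "F n \<mu> (extremal n \<mu>) \<noteq> 0"
    using Parts_D[OF P(2)] by (intro F_extremal_nonzero) auto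
  ultimately show False by simp
qed

section \<open>Noncrossing partitions and adjacent transpositions\<close>

definition same_block :: "setpart \<Rightarrow> nat \<Rightarrow> nat \<Rightarrow> bool" where
  "same_block \<pi> x y \<longleftrightarrow> (\<exists>B\<in>\<pi>. x \<in> B \<and> y \<in> B)"

lemma same_block_sym: "same_block \<pi> x y \<Longrightarrow> same_block \<pi> y x"
  by (auto simp: same_block_def)

lemma same_block_trans:
  "\<pi> \<in> Parts n \<Longrightarrow> same_block \<pi> x y \<Longrightarrow> same_block \<pi> y z \<Longrightarrow> same_block \<pi> x z"
  unfolding same_block_def by (metis Parts_eq_block)

lemma noncrossing_iff:
  assumes "\<pi> \<in> Parts n"
  shows "noncrossing \<pi> \<longleftrightarrow> (\<forall>a b c d. a < b \<and> b < c \<and> c < d \<and> same_block \<pi> a c \<and> same_block \<pi> b d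
    \<longrightarrow> same_block \<pi> a b)"
proof -
  have "(\<exists>B\<in>\<pi>. {a, b, c, d} \<subseteq> B) \<longleftrightarrow> same_block \<pi> a b"
    if *: "same_block \<pi> a c" "same_block \<pi> b d" for a b c d
  proof
    assume "same_block \<pi> a b"
    then obtain B where "B \<in> \<pi>" "a \<in> B" "b \<in> B"
      by (auto simp: same_block_def)
    moreover from this have "c \<in> B" "d \<in> B"
      using * Parts_eq_block[OF assms] by (metis same_block_def)+
    ultimately show "\<exists>B\<in>\<pi>. {a, b, c, d} \<subseteq> B" by auto
  qed (auto simp: same_block_def)
  then show ?thesis
    unfolding noncrossing_def same_block_def[symmetric] by meson
qed

text \<open>A potential crossing in \<rho> is sent by \<open>f\<close> to a weakly increasing
  quadruple. If it is strict, \<pi> being noncrossing applies; if two neighbours coincide,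
  transitivity already joins the blocks. The set \<open>S\<close> may omit singletons of \<rho>,
  where \<open>f\<close> need not be monotone.\<close>

lemma noncrossing_pullback:
  assumes \<pi>: "\<pi> \<in> Parts n" "noncrossing \<pi>" and \<rho>: "\<rho> \<in> Parts n"
    and mono: "mono_on S f"
    and S: "\<And>x y. x < y \<Longrightarrow> same_block \<rho> x y \<Longrightarrow> x \<in> S \<and> y \<in> S"
    and iff: "\<And>x y. x \<in> S \<Longrightarrow> y \<in> S \<Longrightarrow> same_block \<rho> x y \<longleftrightarrow> same_block \<pi> (f x) (f y)"
  shows "noncrossing \<rho>"
  unfolding noncrossing_iff[OF \<rho>]
proof (intro allI impI, elim conjE)
  fix a b c d
  assume *: "a < b" "b < c" "c < d" "same_block \<rho> a c" "same_block \<rho> b d"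
  have mem: "a \<in> S" "b \<in> S" "c \<in> S" "d \<in> S"
    using S[of a c] S[of b d] * by auto
  then have le: "f a \<le> f b" "f b \<le> f c" "f c \<le> f d"
    using mono * by (auto simp: mono_on_def)
  have s: "same_block \<pi> (f a) (f c)" "same_block \<pi> (f b) (f d)"
    using iff mem * by auto
  have "same_block \<pi> (f a) (f b)"
  proof (cases "f a < f b \<and> f b < f c \<and> f c < f d")
    case True
    then show ?thesis
      using \<pi>(2) s unfolding noncrossing_iff[OF \<pi>(1)] by blast
  next
    case False
    then consider "f a = f b" | "f b = f c" | "f c = f d"
      using le by linarith
    then show ?thesis
      by cases (use s same_block_sym same_block_trans[OF \<pi>(1)] in metis)+
  qed
  then show "same_block \<rho> a b"
    using iff mem by blast
qed

text \<open>If \<open>t\<close> were outside, then \<open>t < u < s < v\<close> or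
  \<open>u < s < v < t\<close> would be a crossing of two different blocks.\<close>

lemma noncrossing_side:
  assumes "\<pi> \<in> Parts n" "noncrossing \<pi>" "same_block \<pi> u v" "same_block \<pi> s t"
    "\<not> same_block \<pi> u s" "u < s" "s < v"
  shows "u < t \<and> t < v"
proof (rule ccontr)
  assume "\<not> (u < t \<and> t < v)"
  moreover have "t \<noteq> u" "t \<noteq> v"
    using assms same_block_sym same_block_trans[OF assms(1)] by metis+
  ultimately consider "t < u" | "v < t" by linarith
  then show False
  proof cases
    case 1
    then have "same_block \<pi> t u"
      using assms(2-) same_block_sym unfolding noncrossing_iff[OF assms(1)] by blast
    then show False
      using assms same_block_sym same_block_trans[OF assms(1)] by metis
  next
    case 2
    then show False
      using assms(2-) unfolding noncrossing_iff[OF assms(1)] by blast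
  qed
qed

section \<open>Replacing two blocks that contain neighbouring points\<close>

lemma Parts_replace_two:
  assumes "\<pi> \<in> Parts n" "P \<in> \<pi>" "Q \<in> \<pi>" "X \<union> Y = P \<union> Q" "X \<inter> Y = {}" "X \<noteq> {}" "Y \<noteq> {}"
  shows "(\<pi> - {P, Q}) \<union> {X, Y} \<in> Parts n"
proof -
  have dis: "Z \<inter> X = {} \<and> Z \<inter> Y = {}" if "Z \<in> \<pi> - {P, Q}" for Z
  proof -
    have "Z \<inter> P = {}" "Z \<inter> Q = {}"
      using Parts_D(3)[OF assms(1)] assms(2,3) that by (auto dest: disjointD)
    then show ?thesis
      using assms(4) by auto
  qed
  have "\<Union>((\<pi> - {P, Q}) \<union> {X, Y}) = \<Union>(\<pi> - {P, Q}) \<union> (P \<union> Q)"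
    using assms(4) by auto
  also have "\<dots> = {1..n}"
    using assms(2,3) Parts_D(2)[OF assms(1)] by auto
  finally have "\<Union>((\<pi> - {P, Q}) \<union> {X, Y}) = {1..n}" .
  moreover have "disjoint ((\<pi> - {P, Q}) \<union> {X, Y})"
  proof (rule disjointI)
    fix Z Z' assume "Z \<in> (\<pi> - {P, Q}) \<union> {X, Y}" "Z' \<in> (\<pi> - {P, Q}) \<union> {X, Y}" "Z \<noteq> Z'"
    then consider "Z \<in> \<pi>" "Z' \<in> \<pi>" | "Z \<in> \<pi> - {P, Q}" "Z' \<in> {X, Y}"
      | "Z \<in> {X, Y}" "Z' \<in> \<pi> - {P, Q}" | "Z \<in> {X, Y}" "Z' \<in> {X, Y}"
      by (elim UnE) auto
    then show "Z \<inter> Z' = {}"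
    proof cases
      case 1
      then show ?thesis
        using Parts_D(3)[OF assms(1)] \<open>Z \<noteq> Z'\<close> by (auto dest: disjointD)
    next
      case 2
      then show ?thesis using dis[of Z] by auto
    next
      case 3
      then show ?thesis using dis[of Z'] by auto
    next
      case 4
      then show ?thesis using assms(5) \<open>Z \<noteq> Z'\<close> by auto
    qed
  qed
  moreover have "{} \<notin> (\<pi> - {P, Q}) \<union> {X, Y}"
    using assms(6,7) Parts_D(6)[OF assms(1)] by blast
  ultimately show ?thesis
    by (simp add: Parts_def partition_on_def)
qed

lemma same_block_replace_two:
  assumes "\<pi> \<in> Parts n" "P \<in> \<pi>" "Q \<in> \<pi>"
  shows "same_block ((\<pi> - {P, Q}) \<union> {X, Y}) x y \<longleftrightarrow>
    (same_block \<pi> x y \<and> x \<notin> P \<union> Q) \<or> (x \<in> X \<and> y \<in> X) \<or> (x \<in> Y \<and> y \<in> Y)"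
proof -
  have "same_block (\<pi> - {P, Q}) x y \<longleftrightarrow> same_block \<pi> x y \<and> x \<notin> P \<union> Q"
    unfolding same_block_def using Parts_eq_block[OF assms(1) _ assms(2)]
      Parts_eq_block[OF assms(1) _ assms(3)] by blast
  then show ?thesis
    by (auto simp: same_block_def)
qed

lemma same_block_mem:
  assumes "\<pi> \<in> Parts n" "P \<in> \<pi>" "same_block \<pi> x y"
  shows "x \<in> P \<longleftrightarrow> y \<in> P"
  using assms unfolding same_block_def by (metis Parts_eq_block)

lemma same_block_iff:
  assumes "\<pi> \<in> Parts n" "P \<in> \<pi>" "u \<in> P"
  shows "same_block \<pi> u v \<longleftrightarrow> v \<in> P" "same_block \<pi> v u \<longleftrightarrow> v \<in> P"
  using same_block_mem[OF assms(1,2)] assms(2,3) by (auto simp: same_block_def)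

text \<open>Suppose \<open>u\<close> and \<open>v\<close> share a block other than \<open>P\<close>
  and \<open>Q\<close>, and a point of \<open>P \<union> Q\<close> lies between them. By
  \<open>noncrossing_side\<close>, \<open>i\<close> or \<open>Suc i\<close> lies between them; being
  neighbours, both do, and then so does all of \<open>P \<union> Q\<close>. Thus the merged block
  crosses no old one.\<close>

lemma noncrossing_merge:
  assumes \<pi>: "\<pi> \<in> Parts n" "noncrossing \<pi>" and PQ: "P \<in> \<pi>" "Q \<in> \<pi>" "i \<in> P" "Suc i \<in> Q"
    and \<rho>: "(\<pi> - {P, Q}) \<union> {(P \<union> Q) - {i, Suc i}, {i, Suc i}} \<in> Parts n" (is "?\<rho> \<in> _")
  shows "noncrossing ?\<rho>"
  unfolding noncrossing_iff[OF \<rho>]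
proof (intro allI impI, elim conjE)
  fix a b c d
  assume *: "a < b" "b < c" "c < d" "same_block ?\<rho> a c" "same_block ?\<rho> b d"
  note same = same_block_replace_two[OF \<pi>(1) PQ(1,2)]
  have PQ_mem: "x \<in> P \<union> Q \<longleftrightarrow> y \<in> P \<union> Q" if "same_block \<pi> x y" for x y
    using same_block_mem[OF \<pi>(1) PQ(1) that] same_block_mem[OF \<pi>(1) PQ(2) that] by auto
  have inside: "u < t \<and> t < v"
    if "same_block \<pi> u v" "u \<notin> P \<union> Q" "s \<in> P \<union> Q" "t \<in> P \<union> Q" "u < s" "s < v" for u v s t
  proof -
    have v: "v \<notin> P \<union> Q"
      using that PQ_mem by blast
    have side: "u < y \<and> y < v" if "x \<in> P \<and> y \<in> P \<or> x \<in> Q \<and> y \<in> Q" "u < x \<and> x < v" for x y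
    proof (rule noncrossing_side[OF \<pi> \<open>same_block \<pi> u v\<close>, of x])
      show "same_block \<pi> x y"
        using that(1) PQ by (auto simp: same_block_def)
      show "\<not> same_block \<pi> u x"
        using PQ_mem \<open>u \<notin> P \<union> Q\<close> that(1) by blast
    qed (use that in auto)
    have "u \<noteq> i" "u \<noteq> Suc i" "v \<noteq> i" "v \<noteq> Suc i"
      using v PQ that by auto
    moreover have "u < i \<and> i < v \<or> u < Suc i \<and> Suc i < v"
      using side[of s] that PQ by blast
    ultimately have "u < i \<and> i < v" "u < Suc i \<and> Suc i < v"
      by linarith+
    then show ?thesis
      using side[of i t] side[of "Suc i" t] PQ that by blast
  qed
  let ?M = "(P \<union> Q) - {i, Suc i}"
  have ac: "same_block \<pi> a c \<and> a \<notin> P \<union> Q \<or> a \<in> ?M \<and> c \<in> ?M"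
    and bd: "same_block \<pi> b d \<and> b \<notin> P \<union> Q \<or> b \<in> ?M \<and> d \<in> ?M"
  proof -
    \<comment> \<open>The block \<open>{i, Suc i}\<close> cannot take part in a crossing, as no
      element lies strictly between its two points.\<close>
    have "\<not> (a \<in> {i, Suc i} \<and> c \<in> {i, Suc i})" "\<not> (b \<in> {i, Suc i} \<and> d \<in> {i, Suc i})"
      using \<open>a < b\<close> \<open>b < c\<close> \<open>c < d\<close> by auto
    then show "same_block \<pi> a c \<and> a \<notin> P \<union> Q \<or> a \<in> ?M \<and> c \<in> ?M"
      "same_block \<pi> b d \<and> b \<notin> P \<union> Q \<or> b \<in> ?M \<and> d \<in> ?M"
      using *(4,5) unfolding same by blast+
  qed
  from ac bd show "same_block ?\<rho> a b"
  proof (elim disjE conjE)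
    assume "same_block \<pi> a c" "same_block \<pi> b d" "a \<notin> P \<union> Q"
    moreover from this have "same_block \<pi> a b"
      using \<pi>(2) * unfolding noncrossing_iff[OF \<pi>(1)] by blast
    ultimately show ?thesis
      unfolding same by blast
  next
    assume "same_block \<pi> a c" "a \<notin> P \<union> Q" "b \<in> ?M" "d \<in> ?M"
    then show ?thesis
      using inside[of a c b d] * by auto
  next
    assume "a \<in> ?M" "c \<in> ?M" "same_block \<pi> b d" "b \<notin> P \<union> Q"
    then show ?thesis
      using inside[of b d c a] * by auto
  next
    assume "a \<in> ?M" "b \<in> ?M"
    then show ?thesis
      unfolding same by blast
  qed
qed

text \<open>The new partition is the pullback of \<pi> along the weakly monotone map that collapses
  \<open>Suc i\<close> to \<open>i\<close>.\<close>

lemma noncrossing_absorb_right: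
  assumes \<pi>: "\<pi> \<in> Parts n" "noncrossing \<pi>" and PQ: "P \<in> \<pi>" "Q \<in> \<pi>" "i \<in> P" "Suc i \<in> Q" "P \<noteq> Q"
    and \<rho>: "(\<pi> - {P, Q}) \<union> {Q - {Suc i}, insert (Suc i) P} \<in> Parts n" (is "?\<rho> \<in> _")
  shows "noncrossing ?\<rho>"
proof (rule noncrossing_pullback[OF \<pi> \<rho>])
  let ?f = "\<lambda>x. if x = Suc i then i else x"
  show "mono_on UNIV ?f"
    by (auto simp: mono_on_def)
  fix x y :: nat
  note mem = same_block_iff[OF \<pi>(1)]
  have dis: "z \<notin> Q" if "z \<in> P" for z
    using Parts_eq_block[OF \<pi>(1) PQ(1,2) that] PQ(5) by blast
  show "same_block ?\<rho> x y \<longleftrightarrow> same_block \<pi> (?f x) (?f y)"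
    unfolding same_block_replace_two[OF \<pi>(1) PQ(1,2)]
    using PQ(3,4) dis[of x] dis[of i] mem[OF PQ(1,3)] mem[OF PQ(2,4)] mem(1)[OF PQ(1), of x y]
      mem(1)[OF PQ(2), of x y]
    by (cases "x = Suc i"; cases "y = Suc i"; cases "x \<in> P"; cases "x \<in> Q") simp_all
qed auto

text \<open>Mirror image of the preceding lemma: here \<open>i\<close> is collapsed to
  \<open>Suc i\<close>.\<close>

lemma noncrossing_absorb_left:
  assumes \<pi>: "\<pi> \<in> Parts n" "noncrossing \<pi>" and PQ: "P \<in> \<pi>" "Q \<in> \<pi>" "i \<in> P" "Suc i \<in> Q" "P \<noteq> Q"
    and \<rho>: "(\<pi> - {P, Q}) \<union> {P - {i}, insert i Q} \<in> Parts n" (is "?\<rho> \<in> _")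
  shows "noncrossing ?\<rho>"
proof (rule noncrossing_pullback[OF \<pi> \<rho>])
  let ?f = "\<lambda>x. if x = i then Suc i else x"
  show "mono_on UNIV ?f"
    by (auto simp: mono_on_def)
  fix x y :: nat
  note mem = same_block_iff[OF \<pi>(1)]
  have dis: "z \<notin> Q" if "z \<in> P" for z
    using Parts_eq_block[OF \<pi>(1) PQ(1,2) that] PQ(5) by blast
  show "same_block ?\<rho> x y \<longleftrightarrow> same_block \<pi> (?f x) (?f y)"
    unfolding same_block_replace_two[OF \<pi>(1) PQ(1,2)]
    using PQ(3,4) dis[of x] dis[of i] mem[OF PQ(1,3)] mem[OF PQ(2,4)] mem(1)[OF PQ(1), of x y]
      mem(1)[OF PQ(2), of x y]
    by (cases "x = i"; cases "y = i"; cases "x \<in> P"; cases "x \<in> Q") simp_all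
qed auto

lemma perm_part_Parts:
  assumes "\<pi> \<in> Parts n" "w permutes {1..n}"
  shows "perm_part w \<pi> \<in> Parts n"
proof -
  have "partition_on (w ` {1..n}) ((`) w ` \<pi> - {{}})"
    using assms by (intro partition_on_inj_image) (auto simp: Parts_def permutes_inj_on)
  moreover have "{} \<notin> (`) w ` \<pi>"
    using Parts_D(6)[OF assms(1)] by auto
  ultimately show ?thesis
    using permutes_image[OF assms(2)] by (simp add: Parts_def perm_part_def)
qed

lemma same_block_perm_part_adj:
  "same_block (perm_part (adj i) \<pi>) x y \<longleftrightarrow> same_block \<pi> (adj i x) (adj i y)"
proof -
  have "x \<in> adj i ` B \<longleftrightarrow> adj i x \<in> B" for x B
    by (metis imageE imageI transpose_involutory)
  then show ?thesis
    by (simp add: same_block_def perm_part_def)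
qed

lemma adj_permutes: "i \<in> {1..<n} \<Longrightarrow> adj i permutes {1..n}"
  by (rule permutes_swap_id) auto

text \<open>In each excluded case the swapped partition is a monotone pullback of \<pi>. If
  \<open>P = Q\<close>, the swap changes nothing. If one of the two points is a singleton, its image
  is a singleton too and can be left out; on the other points \<open>adj i\<close> preserves the
  order.\<close>

lemma crossing_adj_blocks:
  assumes \<pi>: "\<pi> \<in> NC n" and i: "i \<in> {1..<n}" and cr: "\<not> noncrossing (perm_part (adj i) \<pi>)"
    and PQ: "P \<in> \<pi>" "Q \<in> \<pi>" "i \<in> P" "Suc i \<in> Q"
  shows "P \<noteq> Q" "P \<noteq> {i}" "Q \<noteq> {Suc i}"
proof -
  let ?\<mu> = "perm_part (adj i) \<pi>"
  have P: "\<pi> \<in> Parts n" "noncrossing \<pi>"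
    using \<pi> by (auto simp: NC_def)
  note \<mu> = perm_part_Parts[OF P(1) adj_permutes[OF i]]
  note same = same_block_perm_part_adj
  have mem: "same_block \<pi> i v \<longleftrightarrow> v \<in> P" "same_block \<pi> (Suc i) v \<longleftrightarrow> v \<in> Q"
    "same_block \<pi> v i \<longleftrightarrow> v \<in> P" "same_block \<pi> v (Suc i) \<longleftrightarrow> v \<in> Q" for v
    using same_block_iff[OF P(1) PQ(1,3)] same_block_iff[OF P(1) PQ(2,4)] by simp_all
  show "P \<noteq> Q"
  proof
    assume "P = Q"
    have "noncrossing ?\<mu>"
    proof (rule noncrossing_pullback[OF P \<mu>, where S = UNIV and f = id])
      show "same_block ?\<mu> x y \<longleftrightarrow> same_block \<pi> (id x) (id y)" for x y
        unfolding same using mem[unfolded \<open>P = Q\<close>] PQ(3,4)[unfolded \<open>P = Q\<close>]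
        by (cases "x = Suc i"; cases "y = Suc i"; cases "x = i"; cases "y = i") simp_all
    qed (auto simp: mono_on_def)
    with cr show False by simp
  qed
  show "P \<noteq> {i}"
  proof
    assume "P = {i}"
    have "noncrossing ?\<mu>"
    proof (rule noncrossing_pullback[OF P \<mu>, where S = "- {Suc i}" and f = "adj i"])
      show "x \<in> - {Suc i} \<and> y \<in> - {Suc i}" if "x < y" "same_block ?\<mu> x y" for x y
        using that mem(1,3)[unfolded \<open>P = {i}\<close>] unfolding same
        by (cases "x = Suc i"; cases "y = Suc i"; cases "x = i"; cases "y = i") simp_all
    qed (auto simp: mono_on_def same transpose_def)
    with cr show False by simp
  qed
  show "Q \<noteq> {Suc i}"
  proof
    assume "Q = {Suc i}"
    have "noncrossing ?\<mu>"
    proof (rule noncrossing_pullback[OF P \<mu>, where S = "- {i}" and f = "adj i"])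
      show "x \<in> - {i} \<and> y \<in> - {i}" if "x < y" "same_block ?\<mu> x y" for x y
        using that mem(2,4)[unfolded \<open>Q = {Suc i}\<close>] unfolding same
        by (cases "x = Suc i"; cases "y = Suc i"; cases "x = i"; cases "y = i") simp_all
    qed (auto simp: mono_on_def same transpose_def)
    with cr show False by simp
  qed
qed

section \<open>The skein action on fermions\<close>

lemma NC_subset_Parts: "\<pi> \<in> NC n \<Longrightarrow> \<pi> \<in> Parts n"
  by (simp add: NC_def)

text \<open>Equations between vectors of \<complex>[NC(n)] are checked below by comparing their
  images under \<pi> \<mapsto> \<open>F n \<pi>\<close>.\<close>

lemma lin_ext_F_inj:
  assumes "c \<in> free_space (NC n)" "d \<in> free_space (NC n)"
    and "lin_ext (NC n) (F n) c = lin_ext (NC n) (F n) d"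
  shows "c = d"
proof -
  have "lin_ext (NC n) (F n) (c - d) = 0"
    using assms(3) by (simp add: lin_diff[OF lin_lin_ext])
  then show ?thesis
    using F_NC_independent[of "c - d" n] fun_space.subspace_diff[OF subspace_free_space assms(1,2)]
    by (simp add: lin_ext_def)
qed

lemma skein_resolve_F:
  assumes \<pi>: "\<pi> \<in> NC n" and i: "i \<in> {1..<n}" and cr: "\<not> noncrossing (perm_part (adj i) \<pi>)"
  defines "\<mu> \<equiv> perm_part (adj i) \<pi>"
  shows "skein_resolve i \<mu> \<in> free_space (NC n)"
    and "lin_ext (NC n) (F n) (skein_resolve i \<mu>) = - F n \<mu>"
proof -
  have p: "\<pi> \<in> Parts n" "noncrossing \<pi>"
    using \<pi> by (auto simp: NC_def)
  have \<mu>: "\<mu> \<in> Parts n"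
    unfolding \<mu>_def by (rule perm_part_Parts[OF p(1) adj_permutes[OF i]])
  obtain P Q where PQ: "P \<in> \<pi>" "Q \<in> \<pi>" "i \<in> P" "Suc i \<in> Q"
    using block_of_mem[OF p(1), of i] block_of_mem[OF p(1), of "Suc i"] i by auto
  note ne = crossing_adj_blocks[OF \<pi> i cr PQ]
  have dis: "P \<inter> Q = {}"
    using Parts_D(3)[OF p(1)] PQ(1,2) ne(1) by (rule disjointD)
  define R where "R = \<pi> - {P, Q}"
  \<comment> \<open>The swap exchanges the two points, so \<open>A\<close> is the rest of the block
    of \<open>i\<close> in \<mu>, and \<open>D\<close> the rest of the block of
    \<open>Suc i\<close>.\<close>
  define A where "A = Q - {Suc i}"
  define D where "D = P - {i}"
  have AD: "finite A" "finite D" "A \<noteq> {}" "D \<noteq> {}" "A \<inter> D = {}"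
    and ab: "i \<notin> A" "i \<notin> D" "Suc i \<notin> A" "Suc i \<notin> D" "i \<noteq> Suc i"
    using PQ ne dis Parts_D(5)[OF p(1)] by (auto simp: A_def D_def)
  have PQ_eq: "P = insert i D" "Q = insert (Suc i) A"
    using PQ by (auto simp: A_def D_def)
  have R: "X \<inter> (A \<union> D \<union> {i, Suc i}) = {}" if "X \<in> R" for X
  proof -
    have "X \<inter> P = {}" "X \<inter> Q = {}"
      using Parts_D(3)[OF p(1)] PQ(1,2) that by (auto simp: R_def dest: disjointD)
    then show ?thesis
      by (auto simp: PQ_eq)
  qed
  have "finite R"
    using Parts_D(4)[OF p(1)] by (simp add: R_def)
  have \<pi>_eq: "\<pi> = R \<union> {insert (Suc i) A, insert i D}"
    using PQ by (auto simp: R_def PQ_eq)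
  have fixed: "adj i ` X = X" if "i \<notin> X" "Suc i \<notin> X" for X
    using that by (auto simp: transpose_def image_iff)
  have "adj i ` insert (Suc i) A = insert i A" "adj i ` insert i D = insert (Suc i) D"
    using fixed[of A] fixed[of D] ab by auto
  moreover have "(`) (adj i) ` R = R"
    using R fixed by (auto simp: image_iff)
  ultimately have \<mu>_eq: "\<mu> = R \<union> {insert i A, insert (Suc i) D}"
    by (simp add: \<mu>_def perm_part_def \<pi>_eq)
  have blocks: "block_of \<mu> i = insert i A" "block_of \<mu> (Suc i) = insert (Suc i) D"
    by (rule block_of_eq[OF \<mu>]; simp add: \<mu>_eq)+
  have notin: "insert i A \<notin> R" "insert (Suc i) D \<notin> R"
    using R by blast+
  \<comment> \<open>The first partition of the resolution is \<pi> itself, and the size conditions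
    on the blocks of \<mu> turn into those of \<open>F_skein\<close> on \<open>A\<close> and
    \<open>D\<close>.\<close>
  have res: "skein_resolve i \<mu> = basis_vec \<pi> + basis_vec (R \<union> {A \<union> D, {i, Suc i}})
    - (if card A > 1 then basis_vec (R \<union> {A, insert i (insert (Suc i) D)}) else 0)
    - (if card D > 1 then basis_vec (R \<union> {D, insert i (insert (Suc i) A)}) else 0)"
  proof -
    have "\<mu> - {insert i A, insert (Suc i) D} = R"
      using notin by (auto simp: \<mu>_eq)
    moreover have "insert i A - {i} = A" "insert (Suc i) D - {Suc i} = D"
      "insert i A \<union> insert (Suc i) D - {i, Suc i} = A \<union> D"
      "A \<union> {Suc i} = insert (Suc i) A" "D \<union> {i} = insert i D"
      "insert (Suc i) D \<union> {i} = insert i (insert (Suc i) D)"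
      "insert i A \<union> {Suc i} = insert i (insert (Suc i) A)"
      "card (insert i A) > 2 \<longleftrightarrow> card A > 1" "card (insert (Suc i) D) > 2 \<longleftrightarrow> card D > 1"
      using ab AD by auto
    ultimately show ?thesis
      unfolding skein_resolve_def Let_def blocks by (simp only: \<pi>_eq)
  qed
  \<comment> \<open>The other three partitions are obtained from the noncrossing \<pi>: by merging
    \<open>P\<close> and \<open>Q\<close> apart from the two points, or by letting one block absorb
    the neighbouring point of the other.\<close>
  have n2: "R \<union> {A \<union> D, {i, Suc i}} \<in> NC n"
  proof -
    have eq: "A \<union> D = (P \<union> Q) - {i, Suc i}"
      using ab by (auto simp: PQ_eq)
    have "R \<union> {(P \<union> Q) - {i, Suc i}, {i, Suc i}} \<in> Parts n"
      unfolding R_def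
    proof (rule Parts_replace_two[OF p(1) PQ(1,2)])
      show "P \<union> Q - {i, Suc i} \<noteq> {}"
        using AD(3) by (simp flip: eq)
    qed (use PQ in auto)
    with noncrossing_merge[OF p PQ] show ?thesis
      by (simp add: NC_def eq R_def)
  qed
  have n3: "R \<union> {A, insert i (insert (Suc i) D)} \<in> NC n"
  proof -
    have "R \<union> {Q - {Suc i}, insert (Suc i) P} \<in> Parts n"
      unfolding R_def using PQ AD ab dis by (intro Parts_replace_two[OF p(1)]) (auto simp: A_def)
    with noncrossing_absorb_right[OF p PQ ne(1)] show ?thesis
      by (simp add: NC_def R_def A_def PQ_eq(1) insert_commute)
  qed
  have n4: "R \<union> {D, insert i (insert (Suc i) A)} \<in> NC n"
  proof -
    have "R \<union> {P - {i}, insert i Q} \<in> Parts n"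
      unfolding R_def using PQ AD ab dis by (intro Parts_replace_two[OF p(1)]) (auto simp: D_def)
    with noncrossing_absorb_left[OF p PQ ne(1)] show ?thesis
      by (simp add: NC_def R_def D_def PQ_eq(2))
  qed
  note sub = fun_space.subspace_add[OF subspace_free_space] fun_space.subspace_diff[OF subspace_free_space]
    fun_space.subspace_0[OF subspace_free_space] basis_vec_in_free_space
  show "skein_resolve i \<mu> \<in> free_space (NC n)"
    unfolding res using \<pi> n2 n3 n4 by (auto intro!: sub)
  have "lin_ext (NC n) (F n) (skein_resolve i \<mu>) = F n \<pi> + F n (R \<union> {A \<union> D, {i, Suc i}})
    - (if card A > 1 then F n (R \<union> {A, insert i (insert (Suc i) D)}) else 0)
    - (if card D > 1 then F n (R \<union> {D, insert i (insert (Suc i) A)}) else 0)"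
    unfolding res using \<pi> n2 n3 n4
    by (auto simp: lin_add[OF lin_lin_ext] lin_diff[OF lin_lin_ext] lin_zero[OF lin_lin_ext]
        lin_ext_basis_vec[OF finite_NC])
  moreover have "F n \<mu> + F n \<pi> + F n (R \<union> {A \<union> D, {i, Suc i}})
    = (if card A > 1 then F n (R \<union> {A, insert i (insert (Suc i) D)}) else 0)
    + (if card D > 1 then F n (R \<union> {D, insert i (insert (Suc i) A)}) else 0)"
    unfolding \<mu>_eq \<pi>_eq by (rule F_skein[OF \<open>finite R\<close> AD ab R])
  ultimately show "lin_ext (NC n) (F n) (skein_resolve i \<mu>) = - F n \<mu>"
    by (simp only:) (simp only: eq_neg_iff_add_eq_0 add_0_left algebra_simps)
qed

lemma swap_op_F_Parts:
  "i \<in> {1..<n} \<Longrightarrow> \<pi> \<in> Parts n \<Longrightarrow> swap_op i (F n \<pi>) = - F n (perm_part (adj i) \<pi>)"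
  using Parts_D(4-6) by (intro swap_op_F) auto

lemma skein_gen_F:
  assumes "i \<in> {1..<n}"
  shows "skein_gen n i c \<in> free_space (NC n)"
    and "lin_ext (NC n) (F n) (skein_gen n i c) = swap_op i (lin_ext (NC n) (F n) c)"
proof -
  let ?T = "\<lambda>\<pi>. if noncrossing (perm_part (adj i) \<pi>) then - basis_vec (perm_part (adj i) \<pi>)
           else skein_resolve i (perm_part (adj i) \<pi>)"
  have T: "?T \<pi> \<in> free_space (NC n) \<and> lin_ext (NC n) (F n) (?T \<pi>) = swap_op i (F n \<pi>)"
    if \<pi>: "\<pi> \<in> NC n" for \<pi>
  proof (cases "noncrossing (perm_part (adj i) \<pi>)")
    case True
    then have "perm_part (adj i) \<pi> \<in> NC n"
      using perm_part_Parts[OF NC_subset_Parts[OF \<pi>] adj_permutes[OF assms]] by (simp add: NC_def)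
    with True show ?thesis
      using swap_op_F_Parts[OF assms NC_subset_Parts[OF \<pi>]]
      by (simp add: fun_space.subspace_neg[OF subspace_free_space] basis_vec_in_free_space
          lin_neg[OF lin_lin_ext] lin_ext_basis_vec[OF finite_NC])
  next
    case False
    then show ?thesis
      using swap_op_F_Parts[OF assms NC_subset_Parts[OF \<pi>]] skein_resolve_F[OF \<pi> assms False] by simp
  qed
  show "skein_gen n i c \<in> free_space (NC n)"
    unfolding skein_gen_def using T by (intro lin_ext_in_subspace[OF subspace_free_space]) blast
  show "lin_ext (NC n) (F n) (skein_gen n i c) = swap_op i (lin_ext (NC n) (F n) c)"
    unfolding skein_gen_def lin_ext_apply_lin[OF lin_lin_ext] lin_ext_apply_lin[OF lin_swap_op]
    using T by (intro lin_ext_cong) blast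
qed

section \<open>Words in the adjacent transpositions\<close>

definition adj_word :: "nat list \<Rightarrow> nat \<Rightarrow> nat" where
  "adj_word is = foldr (\<lambda>i g. adj i \<circ> g) is id"

lemma adj_word_simps [simp]: "adj_word [] = id" "adj_word (i # is) = adj i \<circ> adj_word is"
  by (simp_all add: adj_word_def)

lemma adj_word_append: "adj_word (is @ js) = adj_word is \<circ> adj_word js"
  by (induction "is") (simp_all add: o_assoc)

lemma adj_word_eq_apply_adj_transps: "adj_word is = apply_adj_transps is"
  by (induction "is") simp_all

lemma adj_word_permutes: "set is \<subseteq> {1..<n} \<Longrightarrow> adj_word is permutes {1..n}"
  by (induction "is") (auto intro!: permutes_compose permutes_swap_id simp: permutes_id)

lemma exists_adj_word:
  assumes "w permutes {1..n}"
  shows "\<exists>is. set is \<subseteq> {1..<n} \<and> w = adj_word is"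
  using assms finite_atLeastAtMost
proof (induction rule: permutes_induct)
  case id
  show ?case by (rule exI[of _ "[]"]) simp
next
  case (swap a b p)
  then obtain js where js: "set js \<subseteq> {1..<n}" "p = adj_word js" by blast
  have "\<exists>is. set is \<subseteq> {1..<n} \<and> transpose x y = adj_word is" if "x < y" "1 \<le> x" "y \<le> n" for x y
    using adj_transp_seq_correct[OF that(1)] set_adj_transp_seq[OF that(1)] that(2,3)
    by (intro exI[of _ "adj_transp_seq x y"]) (auto simp: adj_word_eq_apply_adj_transps)
  from this[of a b] this[of b a]
  have "\<exists>is. set is \<subseteq> {1..<n} \<and> transpose a b = adj_word is"
    using swap.hyps by (cases "a < b") (simp_all add: transpose_commute[of b a])
  then obtain "is" where "set is \<subseteq> {1..<n}" "transpose a b = adj_word is"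
    by blast
  with js show ?case
    by (intro exI[of _ "is @ js"]) (simp add: adj_word_append)
qed

lemma perm_part_comp: "perm_part (v \<circ> w) \<pi> = perm_part v (perm_part w \<pi>)"
  by (simp add: perm_part_def image_image image_comp)

section \<open>Spanning by the noncrossing partitions\<close>

text \<open>Blocks are numbered one after another: each new block receives the consecutive labels
  following those already used.\<close>

lemma exists_interval_relabelling:
  assumes "finite P" "\<And>B. B \<in> P \<Longrightarrow> finite B" "disjoint P"
  shows "\<exists>f. bij_betw f (\<Union>P) {1..card (\<Union>P)} \<and> (\<forall>B\<in>P. \<exists>k l. f ` B = {k..l::nat})"
  using assms
proof (induction P)
  case empty
  show ?case by (simp add: bij_betw_def)
next
  case (insert B P)
  let ?m = "card (\<Union>P)"
  obtain f where f: "bij_betw f (\<Union>P) {1..?m}" "\<And>C. C \<in> P \<Longrightarrow> \<exists>k l. f ` C = {k..l}"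
    using insert by (auto simp: disjoint_def)
  have "finite B"
    using insert.prems by simp
  then obtain h where h: "bij_betw h B {?m + 1..?m + card B}"
    using finite_same_card_bij[of B "{?m + 1..?m + card B}"] by auto
  have dis: "B \<inter> C = {}" if "C \<in> P" for C
    using disjointD[OF insert.prems(2), of B C] insert.hyps(2) that by blast
  define g where "g x = (if x \<in> B then h x else f x)" for x
  have gB: "g ` B = h ` B"
    by (auto simp: g_def)
  have gC: "g ` C = f ` C" if "C \<in> P" for C
    using dis[OF that] by (auto simp: g_def)
  have "bij_betw g B {?m + 1..?m + card B}"
    using h by (rule bij_betw_cong[THEN iffD1, rotated]) (simp add: g_def)
  moreover have "bij_betw g (\<Union>P) {1..?m}"
    using f(1) by (rule bij_betw_cong[THEN iffD1, rotated]) (use dis in \<open>auto simp: g_def\<close>)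
  ultimately have "bij_betw g (B \<union> \<Union>P) ({?m + 1..?m + card B} \<union> {1..?m})"
    by (rule bij_betw_combine) auto
  moreover have "{?m + 1..?m + card B} \<union> {1..?m} = {1..card (\<Union>(insert B P))}"
  proof -
    have "card (B \<union> \<Union>P) = card B + ?m"
      using \<open>finite B\<close> insert.hyps(1) insert.prems(1) dis by (intro card_Un_disjoint) auto
    then show ?thesis by auto
  qed
  ultimately have "bij_betw g (\<Union>(insert B P)) {1..card (\<Union>(insert B P))}"
    by simp
  moreover have "\<exists>k l. g ` C = {k..l}" if "C \<in> insert B P" for C
    using that f(2) gC gB h unfolding bij_betw_def by auto
  ultimately show ?case by blast
qed

lemma exists_perm_NC:
  assumes "\<pi> \<in> Parts n"
  shows "\<exists>w. w permutes {1..n} \<and> perm_part w \<pi> \<in> NC n"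
proof -
  obtain f where f: "bij_betw f {1..n} {1..n}" "\<And>B. B \<in> \<pi> \<Longrightarrow> \<exists>k l. f ` B = {k..l}"
    using exists_interval_relabelling[OF Parts_D(4,5,3)[OF assms]]
    by (auto simp: Parts_D(2)[OF assms])
  define w where "w x = (if x \<in> {1..n} then f x else x)" for x
  have "bij_betw w {1..n} {1..n}"
    using f(1) by (rule bij_betw_cong[THEN iffD1, rotated]) (simp add: w_def)
  then have w: "w permutes {1..n}"
    by (rule bij_imp_permutes) (auto simp: w_def)
  note P = perm_part_Parts[OF assms w]
  have int: "\<exists>k l. B = {k..l}" if B: "B \<in> perm_part w \<pi>" for B
  proof -
    obtain C where C: "C \<in> \<pi>" "B = w ` C"
      using B by (auto simp: perm_part_def)
    have "w ` C = f ` C"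
      using Parts_D(7)[OF assms C(1)] by (intro image_cong) (auto simp: w_def)
    with f(2)[OF C(1)] C(2) show ?thesis by simp
  qed
  have "noncrossing (perm_part w \<pi>)"
    unfolding noncrossing_iff[OF P]
  proof (intro allI impI, elim conjE)
    fix a b c d :: nat
    assume *: "a < b" "b < c" "same_block (perm_part w \<pi>) a c"
    then obtain B where B: "B \<in> perm_part w \<pi>" "a \<in> B" "c \<in> B"
      by (auto simp: same_block_def)
    then have "b \<in> B"
      using int[OF B(1)] * by auto
    with B show "same_block (perm_part w \<pi>) a b"
      by (auto simp: same_block_def)
  qed
  with P w show ?thesis
    by (auto simp: NC_def)
qed

text \<open>The relabelling to intervals is undone one adjacent transposition at a time. If
  \<open>c\<close> represents \<open>F\<close> at a partition, then \<open>- skein_gen n i c\<close>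
  represents it at the image under \<open>adj i\<close>; the minus cancels the sign in
  \<open>swap_op_F_Parts\<close>.\<close>

lemma F_in_NC_span:
  assumes "\<pi> \<in> Parts n"
  shows "\<exists>c\<in>free_space (NC n). lin_ext (NC n) (F n) c = F n \<pi>"
proof -
  obtain w where w: "w permutes {1..n}" "perm_part w \<pi> \<in> NC n"
    using exists_perm_NC[OF assms] by blast
  define \<nu> where "\<nu> = perm_part w \<pi>"
  have \<nu>: "\<nu> \<in> NC n"
    using w by (simp add: \<nu>_def)
  obtain "is" where "is": "set is \<subseteq> {1..<n}" "inv w = adj_word is"
    using exists_adj_word[OF permutes_inv[OF w(1)]] by blast
  have "perm_part (adj_word is) \<nu> = \<pi>"
    unfolding \<nu>_def "is"(2)[symmetric] perm_part_comp[symmetric] permutes_inv_o[OF w(1)]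
    by (simp add: perm_part_def)
  moreover have "\<exists>c\<in>free_space (NC n). lin_ext (NC n) (F n) c = F n (perm_part (adj_word is) \<nu>)"
    using "is"(1)
  proof (induction "is")
    case Nil
    then show ?case
      using \<nu> by (intro bexI[of _ "basis_vec \<nu>"])
        (simp_all add: lin_ext_basis_vec finite_NC basis_vec_in_free_space perm_part_def)
  next
    case (Cons i "is")
    then obtain c where c: "lin_ext (NC n) (F n) c = F n (perm_part (adj_word is) \<nu>)"
      by auto
    have i: "i \<in> {1..<n}"
      using Cons.prems by simp
    have "perm_part (adj_word is) \<nu> \<in> Parts n"
      using Cons.prems \<nu> by (intro perm_part_Parts NC_subset_Parts adj_word_permutes) simp_all
    then have "lin_ext (NC n) (F n) (- skein_gen n i c) = F n (perm_part (adj_word (i # is)) \<nu>)"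
      by (simp add: lin_neg[OF lin_lin_ext] skein_gen_F(2)[OF i] c swap_op_F_Parts[OF i] perm_part_comp
           del: fun_Compl_def)
    then show ?case
      using skein_gen_F(1)[OF i, of c] fun_space.subspace_neg[OF subspace_free_space] by blast
  qed
  ultimately show ?thesis by simp
qed

section \<open>The projection\<close>

lemma proj_coeff:
  assumes "\<pi> \<in> Parts n"
  shows "proj_coeff n \<pi> \<in> free_space (NC n)" "lin_ext (NC n) (F n) (proj_coeff n \<pi>) = F n \<pi>"
proof -
  obtain c where c: "c \<in> free_space (NC n)" "lin_ext (NC n) (F n) c = F n \<pi>"
    using F_in_NC_span[OF assms] by blast
  have "proj_coeff n \<pi> = c"
    unfolding proj_coeff_def lin_ext_def[symmetric]
  proof (rule the_equality)
    show "c' = c" if "c' \<in> free_space (NC n) \<and> F n \<pi> = lin_ext (NC n) (F n) c'" for c'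
      using that c by (intro lin_ext_F_inj[of _ n]) auto
  qed (use c in simp)
  with c show "proj_coeff n \<pi> \<in> free_space (NC n)" "lin_ext (NC n) (F n) (proj_coeff n \<pi>) = F n \<pi>"
    by auto
qed

lemma proj_in_free_space: "proj n v \<in> free_space (NC n)"
  unfolding proj_def using proj_coeff(1) by (intro lin_ext_in_subspace[OF subspace_free_space])

lemma lin_ext_F_proj: "lin_ext (NC n) (F n) (proj n v) = lin_ext (Parts n) (F n) v"
  unfolding proj_def lin_ext_apply_lin[OF lin_lin_ext] using proj_coeff(2) by (intro lin_ext_cong)

lemma lin_ext_F_star:
  assumes "w permutes {1..n}"
  shows "lin_ext (Parts n) (F n) (star n w v)
    = lin_ext (Parts n) (\<lambda>\<pi>. scale (of_int (sign w)) (F n (perm_part w \<pi>))) v"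
  unfolding star_def lin_ext_apply_lin[OF lin_lin_ext]
  by (intro lin_ext_cong) (simp add: lin_scale[OF lin_lin_ext] lin_ext_basis_vec finite_Parts
      perm_part_Parts[OF _ assms])

text \<open>Each letter contributes -1 to the sign of the permutation, matching the -1 by which
  \<open>swap_op\<close> differs from relabelling in \<open>swap_op_F_Parts\<close>.\<close>

lemma lin_ext_F_star_adj_word:
  assumes "set is \<subseteq> {1..<n}"
  shows "lin_ext (Parts n) (F n) (star n (adj_word is) v)
    = foldr swap_op is (lin_ext (Parts n) (F n) v)"
  using assms
proof (induction "is")
  case Nil
  then show ?case
    using lin_ext_F_star[OF permutes_id, of n v] by (simp add: perm_part_def id_def scale_def)
next
  case (Cons i "is")
  let ?w = "adj_word is"
  have i: "i \<in> {1..<n}" and w: "?w permutes {1..n}"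
    using Cons.prems adj_word_permutes[of "is" n] by simp_all
  have "permutation ?w"
    using w by (auto simp: permutation_permutes)
  then have sign: "sign (adj i \<circ> ?w) = - sign ?w"
    by (simp add: sign_compose permutation_swap_id sign_swap_id)
  have "lin_ext (Parts n) (F n) (star n (adj_word (i # is)) v)
    = lin_ext (Parts n) (\<lambda>\<pi>. swap_op i (scale (of_int (sign ?w)) (F n (perm_part ?w \<pi>)))) v"
    unfolding lin_ext_F_star[OF adj_word_permutes[OF Cons.prems]]
    by (rule lin_ext_cong) (simp add: lin_scale[OF lin_swap_op] swap_op_F_Parts[OF i]
        perm_part_Parts[OF _ w] perm_part_comp sign)
  also have "\<dots> = swap_op i (lin_ext (Parts n) (F n) (star n ?w v))"
    by (simp add: lin_ext_apply_lin[OF lin_swap_op] lin_ext_F_star[OF w])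
  also have "lin_ext (Parts n) (F n) (star n ?w v) = foldr swap_op is (lin_ext (Parts n) (F n) v)"
    using Cons by simp
  finally show ?case
    by simp
qed

lemma foldr_skein_gen_F:
  assumes "set is \<subseteq> {1..<n}" "c \<in> free_space (NC n)"
  shows "foldr (skein_gen n) is c \<in> free_space (NC n)"
    and "lin_ext (NC n) (F n) (foldr (skein_gen n) is c) = foldr swap_op is (lin_ext (NC n) (F n) c)"
  using assms by (induction "is") (simp_all add: skein_gen_F)

text \<open>Under the injective map \<pi> \<mapsto> \<open>F n \<pi>\<close> on \<complex>[NC(n)],
  both sides become the same word of \<open>swap_op\<close> applied to the image of
  \<open>v\<close>.\<close>

lemma proj_star_adj_word:
  assumes "set is \<subseteq> {1..<n}"
  shows "proj n (star n (adj_word is) v) = foldr (skein_gen n) is (proj n v)"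
  using assms by (intro lin_ext_F_inj[of _ n])
    (simp_all add: foldr_skein_gen_F proj_in_free_space lin_ext_F_proj lin_ext_F_star_adj_word)

theorem theorem6p5:
  fixes n :: nat
  shows "proj n ` free_space (Parts n) = free_space (NC n) \<and>
    (\<forall>w v. w permutes {1..n} \<longrightarrow> v \<in> free_space (Parts n) \<longrightarrow>
       proj n (star n w v) = skein_act n w (proj n v))"
proof (intro conjI allI impI)
  show "proj n ` free_space (Parts n) = free_space (NC n)"
  proof (intro equalityI subsetI)
    fix c assume c: "c \<in> free_space (NC n)"
    \<comment> \<open>Surjectivity holds because \<open>proj n\<close> fixes every vector supported
      on noncrossing partitions.\<close>
    then have c': "c \<in> free_space (Parts n)"
      by (auto simp: free_space_def NC_def)
    have "lin_ext (Parts n) (F n) c = lin_ext (NC n) (F n) c"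
      unfolding lin_ext_def using c finite_Parts
      by (intro sum.mono_neutral_right) (auto simp: free_space_def NC_def scale_def fun_eq_iff)
    then have "proj n c = c"
      using c by (intro lin_ext_F_inj[of _ n]) (simp_all add: proj_in_free_space lin_ext_F_proj)
    with c' show "c \<in> proj n ` free_space (Parts n)"
      by (metis imageI)
  qed (auto simp: proj_in_free_space)
next
  fix w v assume "w permutes {1..n}"
  then obtain "is" where "is": "set is \<subseteq> {1..<n}" "w = adj_word is"
    using exists_adj_word by blast
  show "proj n (star n w v) = skein_act n w (proj n v)"
    unfolding skein_act_def adj_word_def[symmetric]
  proof (rule the_equality[symmetric])
    show "\<exists>is. set is \<subseteq> {1..<n} \<and> w = adj_word is
        \<and> proj n (star n w v) = foldr (skein_gen n) is (proj n v)"
      using "is" proj_star_adj_word by blast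
    \<comment> \<open>Every word for \<open>w\<close> gives the same value, since
      \<open>proj_star_adj_word\<close> equates it with the left side, which depends only on
      \<open>w\<close>. Thus the description in \<open>skein_act\<close> is unique at
      \<open>proj n v\<close>.\<close>
    show "u = proj n (star n w v)"
      if "\<exists>is. set is \<subseteq> {1..<n} \<and> w = adj_word is \<and> u = foldr (skein_gen n) is (proj n v)" for u
      using that by (elim exE conjE) (simp only: proj_star_adj_word)
  qed
qed

end
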